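(* Let $\mathscr{T}$ be a regular T-mesh with $V^+>0$ crossing vertices and $E$ interior l-edges. Then $$\dim \overline{\mathbf{S}}(2,2,1,1,\mathscr{T})\geqslant V^+-E+1.$$
   Context: A T-mesh is a rectangular grid that allows T-junctions: a region is subdivided by finitely many horizontal and vertical segments into finitely many closed axis-parallel rectangles (the cells) with pairwise disjoint interiors. It is regular if the region $\Omega$ occupied by all its cells is a rectangle. Vertices are the grid points (corners of cells); a vertex on $\partial\Omega$ is a boundary vertex, and an interior vertex is a crossing vertex if four edges meet there and a T-vertex if exactly three edges meet there. A T-vertex is horizontal if a horizontal edge ends there (exactly one of its three edges is horizontal), and vertical if exactly one of its three edges is vertical. Edges are the segments joining adjacent vertices. A horizontal (vertical) l-edge is a continuous line segment consisting of horizontal (vertical) interior edges whose two endpoints are boundary vertices or horizontal (vertical) T-vertices, i.e. a longest possible line segment in the mesh. The boundary of a regular T-mesh consists of four boundary l-edges; all other l-edges are interior l-edges. $\overline{\mathbf{S}}(2,2,1,1,\mathscr{T})$ is the space of functions $f\in C^{1,1}(\mathbb{R}^2)$ (continuous of order $1$ in the $x$ direction and of order $1$ in the $y$ direction) whose restriction to each cell of $\mathscr{T}$ is a biquadratic polynomial (degree at most $2$ in each of $x$ and $y$) and which vanish identically outside $\Omega$. *)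

theory Defs
  imports "HOL-Analysis.Analysis" "HOL-Library.Function_Algebras"
begin

subsection \<open>T-meshes\<close>

definition is_rectangle :: "(real \<times> real) set \<Rightarrow> bool" where
  "is_rectangle K \<longleftrightarrow> (\<exists>a b c d. a < b \<and> c < d \<and> K = {a..b} \<times> {c..d})"

definition corners :: "(real \<times> real) set \<Rightarrow> (real \<times> real) set" where
  "corners K = {(x, y) | x y. \<exists>a b c d. a < b \<and> c < d \<and> K = {a..b} \<times> {c..d} \<and> x \<in> {a, b} \<and> y \<in> {c, d}}"

text \<open>A T-mesh is represented by its set of (closed) cells.\<close>

definition T_mesh :: "(real \<times> real) set set \<Rightarrow> bool" where
  "T_mesh M \<longleftrightarrow> finite M \<and> (\<forall>K\<in>M. is_rectangle K) \<and>
     (\<forall>K\<in>M. \<forall>L\<in>M. K \<noteq> L \<longrightarrow> interior K \<inter> interior L = {})"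

definition region :: "(real \<times> real) set set \<Rightarrow> (real \<times> real) set" where
  "region M = \<Union>M"

definition regular_T_mesh :: "(real \<times> real) set set \<Rightarrow> bool" where
  "regular_T_mesh M \<longleftrightarrow> T_mesh M \<and> is_rectangle (region M)"

definition vertices :: "(real \<times> real) set set \<Rightarrow> (real \<times> real) set" where
  "vertices M = (\<Union>K\<in>M. corners K)"

definition boundary_vertices :: "(real \<times> real) set set \<Rightarrow> (real \<times> real) set" where
  "boundary_vertices M = vertices M \<inter> frontier (region M)"

definition interior_vertices :: "(real \<times> real) set set \<Rightarrow> (real \<times> real) set" where
  "interior_vertices M = vertices M - frontier (region M)"

definition horizontal :: "(real \<times> real) set \<Rightarrow> bool" where
  "horizontal e \<longleftrightarrow> (\<exists>p q. p \<noteq> q \<and> snd p = snd q \<and> e = closed_segment p q)"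

definition vertical :: "(real \<times> real) set \<Rightarrow> bool" where
  "vertical e \<longleftrightarrow> (\<exists>p q. p \<noteq> q \<and> fst p = fst q \<and> e = closed_segment p q)"

text \<open>Two vertices are adjacent if the segment joining them is horizontal or vertical, runs
  along the grid lines (the boundaries of the cells), and has no further vertex on it.\<close>

definition edges :: "(real \<times> real) set set \<Rightarrow> (real \<times> real) set set" where
  "edges M = {closed_segment p q | p q.
     p \<in> vertices M \<and> q \<in> vertices M \<and> p \<noteq> q \<and>
     (horizontal (closed_segment p q) \<or> vertical (closed_segment p q)) \<and>
     closed_segment p q \<subseteq> (\<Union>K\<in>M. frontier K) \<and>
     open_segment p q \<inter> vertices M = {}}"

definition interior_edges :: "(real \<times> real) set set \<Rightarrow> (real \<times> real) set set" where
  "interior_edges M = {e \<in> edges M. \<not> e \<subseteq> frontier (region M)}"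

text \<open>An edge contains no vertices besides its endpoints, so the edges meeting at a vertex are
  those that contain it.\<close>

definition edges_at :: "(real \<times> real) set set \<Rightarrow> real \<times> real \<Rightarrow> (real \<times> real) set set" where
  "edges_at M v = {e \<in> edges M. v \<in> e}"

definition crossing_vertices :: "(real \<times> real) set set \<Rightarrow> (real \<times> real) set" where
  "crossing_vertices M = {v \<in> interior_vertices M. card (edges_at M v) = 4}"

definition T_vertices :: "(real \<times> real) set set \<Rightarrow> (real \<times> real) set" where
  "T_vertices M = {v \<in> interior_vertices M. card (edges_at M v) = 3}"

definition horizontal_T_vertices :: "(real \<times> real) set set \<Rightarrow> (real \<times> real) set" where
  "horizontal_T_vertices M = {v \<in> T_vertices M. card {e \<in> edges_at M v. horizontal e} = 1}"

definition vertical_T_vertices :: "(real \<times> real) set set \<Rightarrow> (real \<times> real) set" where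
  "vertical_T_vertices M = {v \<in> T_vertices M. card {e \<in> edges_at M v. vertical e} = 1}"

text \<open>The l-edges below consist of interior edges, so the four sides of the region are not
  among them.  They are automatically longest possible: a segment of collinear interior edges
  cannot be prolonged at a boundary vertex or at a T-vertex of its own direction.\<close>

definition horizontal_interior_l_edges :: "(real \<times> real) set set \<Rightarrow> (real \<times> real) set set" where
  "horizontal_interior_l_edges M = {closed_segment p q | p q.
     p \<noteq> q \<and> snd p = snd q \<and>
     p \<in> boundary_vertices M \<union> horizontal_T_vertices M \<and>
     q \<in> boundary_vertices M \<union> horizontal_T_vertices M \<and>
     (\<exists>H. H \<subseteq> {e \<in> interior_edges M. horizontal e} \<and> closed_segment p q = \<Union>H)}"

definition vertical_interior_l_edges :: "(real \<times> real) set set \<Rightarrow> (real \<times> real) set set" where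
  "vertical_interior_l_edges M = {closed_segment p q | p q.
     p \<noteq> q \<and> fst p = fst q \<and>
     p \<in> boundary_vertices M \<union> vertical_T_vertices M \<and>
     q \<in> boundary_vertices M \<union> vertical_T_vertices M \<and>
     (\<exists>H. H \<subseteq> {e \<in> interior_edges M. vertical e} \<and> closed_segment p q = \<Union>H)}"

definition interior_l_edges :: "(real \<times> real) set set \<Rightarrow> (real \<times> real) set set" where
  "interior_l_edges M = horizontal_interior_l_edges M \<union> vertical_interior_l_edges M"

subsection \<open>Spline spaces over a T-mesh\<close>

text \<open>\<open>C_class \<alpha> \<beta> f\<close>: all partial derivatives of \<open>f\<close> of order at most \<open>\<alpha>\<close> in \<open>x\<close> and at most
  \<open>\<beta>\<close> in \<open>y\<close> exist and are continuous on the plane; \<open>D i j\<close> is the derivative of order \<open>i\<close> in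
  \<open>x\<close> and \<open>j\<close> in \<open>y\<close>.\<close>

definition C_class :: "nat \<Rightarrow> nat \<Rightarrow> (real \<times> real \<Rightarrow> real) \<Rightarrow> bool" where
  "C_class \<alpha> \<beta> f \<longleftrightarrow> (\<exists>D. D 0 0 = f \<and>
     (\<forall>i\<le>\<alpha>. \<forall>j\<le>\<beta>. continuous_on UNIV (D i j :: real \<times> real \<Rightarrow> real)) \<and>
     (\<forall>i<\<alpha>. \<forall>j\<le>\<beta>. \<forall>x y. ((\<lambda>s. D i j (s, y)) has_real_derivative D (Suc i) j (x, y)) (at x)) \<and>
     (\<forall>i\<le>\<alpha>. \<forall>j<\<beta>. \<forall>x y. ((\<lambda>t. D i j (x, t)) has_real_derivative D i (Suc j) (x, y)) (at y)))"

definition bipoly_on :: "nat \<Rightarrow> nat \<Rightarrow> (real \<times> real) set \<Rightarrow> (real \<times> real \<Rightarrow> real) \<Rightarrow> bool" where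
  "bipoly_on m n K f \<longleftrightarrow>
     (\<exists>c. \<forall>x y. (x, y) \<in> K \<longrightarrow> f (x, y) = (\<Sum>i\<le>m. \<Sum>j\<le>n. c i j * x ^ i * y ^ j))"

definition spline_space_bar ::
    "nat \<Rightarrow> nat \<Rightarrow> nat \<Rightarrow> nat \<Rightarrow> (real \<times> real) set set \<Rightarrow> (real \<times> real \<Rightarrow> real) set" where
  "spline_space_bar m n \<alpha> \<beta> M =
     {f. C_class \<alpha> \<beta> f \<and> (\<forall>K\<in>M. bipoly_on m n K f) \<and> (\<forall>z. z \<notin> region M \<longrightarrow> f z = 0)}"

definition fun_scale :: "real \<Rightarrow> (real \<times> real \<Rightarrow> real) \<Rightarrow> (real \<times> real \<Rightarrow> real)" where
  "fun_scale c f = (\<lambda>z. c * f z)"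

text \<open>\<open>fun_space.dim\<close> is the library's vector space dimension, a natural number that is \<open>0\<close> for
  infinite-dimensional spaces.\<close>

interpretation fun_space: vector_space fun_scale
  by unfold_locales (auto simp: fun_scale_def fun_eq_iff algebra_simps)

lemma C_class_lincomb:
  assumes "C_class \<alpha> \<beta> f" and "C_class \<alpha> \<beta> g"
  shows "C_class \<alpha> \<beta> (\<lambda>z. k * f z + l * g z)"
proof -
  from assms(1)[unfolded C_class_def] obtain D where D: "D 0 0 = f \<and>
     (\<forall>i\<le>\<alpha>. \<forall>j\<le>\<beta>. continuous_on UNIV (D i j)) \<and>
     (\<forall>i<\<alpha>. \<forall>j\<le>\<beta>. \<forall>x y. ((\<lambda>s. D i j (s, y)) has_real_derivative D (Suc i) j (x, y)) (at x)) \<and>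
     (\<forall>i\<le>\<alpha>. \<forall>j<\<beta>. \<forall>x y. ((\<lambda>t. D i j (x, t)) has_real_derivative D i (Suc j) (x, y)) (at y))" ..
  from assms(2)[unfolded C_class_def] obtain E where E: "E 0 0 = g \<and>
     (\<forall>i\<le>\<alpha>. \<forall>j\<le>\<beta>. continuous_on UNIV (E i j)) \<and>
     (\<forall>i<\<alpha>. \<forall>j\<le>\<beta>. \<forall>x y. ((\<lambda>s. E i j (s, y)) has_real_derivative E (Suc i) j (x, y)) (at x)) \<and>
     (\<forall>i\<le>\<alpha>. \<forall>j<\<beta>. \<forall>x y. ((\<lambda>t. E i j (x, t)) has_real_derivative E i (Suc j) (x, y)) (at y))" ..
  show ?thesis
    unfolding C_class_def
  proof (rule exI[of _ "\<lambda>i j z. k * D i j z + l * E i j z"], intro conjI allI impI)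
    show "(\<lambda>z. k * D 0 0 z + l * E 0 0 z) = (\<lambda>z. k * f z + l * g z)"
      using D E by (simp only:)
  next
    fix i j assume "i \<le> \<alpha>" "j \<le> \<beta>"
    from D E \<open>i \<le> \<alpha>\<close> \<open>j \<le> \<beta>\<close> have
      "continuous_on UNIV (D i j)" "continuous_on UNIV (E i j)"
      by simp_all
    then show "continuous_on UNIV (\<lambda>z. k * D i j z + l * E i j z)"
      by (intro continuous_on_add continuous_on_mult_left)
  next
    fix i j x y assume "i < \<alpha>" "j \<le> \<beta>"
    from D E \<open>i < \<alpha>\<close> \<open>j \<le> \<beta>\<close> have
      "((\<lambda>s. D i j (s, y)) has_real_derivative D (Suc i) j (x, y)) (at x)"
      "((\<lambda>s. E i j (s, y)) has_real_derivative E (Suc i) j (x, y)) (at x)"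
      by simp_all
    then show "((\<lambda>s. k * D i j (s, y) + l * E i j (s, y)) has_real_derivative
        k * D (Suc i) j (x, y) + l * E (Suc i) j (x, y)) (at x)"
      by (intro DERIV_add DERIV_cmult)
  next
    fix i j x y assume "i \<le> \<alpha>" "j < \<beta>"
    from D E \<open>i \<le> \<alpha>\<close> \<open>j < \<beta>\<close> have
      "((\<lambda>t. D i j (x, t)) has_real_derivative D i (Suc j) (x, y)) (at y)"
      "((\<lambda>t. E i j (x, t)) has_real_derivative E i (Suc j) (x, y)) (at y)"
      by simp_all
    then show "((\<lambda>t. k * D i j (x, t) + l * E i j (x, t)) has_real_derivative
        k * D i (Suc j) (x, y) + l * E i (Suc j) (x, y)) (at y)"
      by (intro DERIV_add DERIV_cmult)
  qed
qed

lemma bipoly_on_lincomb: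
  assumes "bipoly_on m n K f" and "bipoly_on m n K g"
  shows "bipoly_on m n K (\<lambda>z. k * f z + l * g z)"
proof -
  from assms(1) obtain c where
    c: "\<And>x y. (x, y) \<in> K \<Longrightarrow> f (x, y) = (\<Sum>i\<le>m. \<Sum>j\<le>n. c i j * x ^ i * y ^ j)"
    unfolding bipoly_on_def by blast
  from assms(2) obtain d where
    d: "\<And>x y. (x, y) \<in> K \<Longrightarrow> g (x, y) = (\<Sum>i\<le>m. \<Sum>j\<le>n. d i j * x ^ i * y ^ j)"
    unfolding bipoly_on_def by blast
  show ?thesis
    unfolding bipoly_on_def
    by (intro exI[of _ "\<lambda>i j. k * c i j + l * d i j"] allI impI)
       (simp add: c d sum.distrib sum_distrib_left distrib_right mult.assoc)
qed

lemma subspace_spline_space_bar: "fun_space.subspace (spline_space_bar m n \<alpha> \<beta> M)"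
proof (rule fun_space.subspaceI)
  have "C_class \<alpha> \<beta> (\<lambda>z. 0)"
    unfolding C_class_def by (rule exI[of _ "\<lambda>i j z. 0"]) simp
  moreover have "bipoly_on m n K (\<lambda>z. 0)" for K
    unfolding bipoly_on_def by (rule exI[of _ "\<lambda>i j. 0"]) simp
  ultimately show "0 \<in> spline_space_bar m n \<alpha> \<beta> M"
    by (simp add: spline_space_bar_def zero_fun_def)
next
  fix f g assume "f \<in> spline_space_bar m n \<alpha> \<beta> M" "g \<in> spline_space_bar m n \<alpha> \<beta> M"
  then show "f + g \<in> spline_space_bar m n \<alpha> \<beta> M"
    using C_class_lincomb[of \<alpha> \<beta> f g 1 1] bipoly_on_lincomb[of m n _ f g 1 1]
    by (simp add: spline_space_bar_def plus_fun_def)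
next
  fix k f assume "f \<in> spline_space_bar m n \<alpha> \<beta> M"
  then show "fun_scale k f \<in> spline_space_bar m n \<alpha> \<beta> M"
    using C_class_lincomb[of \<alpha> \<beta> f f k 0] bipoly_on_lincomb[of m n _ f f k 0]
    by (simp add: spline_space_bar_def fun_scale_def)
qed

end

theory Submission
  imports Defs
begin

text \<open>The idea is to write splines through their jumps. For coefficients \<open>w\<close> on the set \<open>V\<close> of all
vertices, boundary vertices included, put
\<open>f(x, y) = (\<Sum>v\<in>V. w v * (x - x\<^sub>v)\<^sub>+\<^sup>2 * (y - y\<^sub>v)\<^sub>+\<^sup>2)\<close>. Such an \<open>f\<close> is always of
class \<open>C\<^sup>1\<^sup>,\<^sup>1\<close>, and \<open>w\<close> can be read off from \<open>f\<close>. It is biquadratic on the cells and vanishes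
outside the region as soon as on each maximal grid segment the jumps across the segment die out past its end,
that is, if the moments
\<open>\<Sum> w v * x\<^sub>v ^ k\<close> (on a horizontal segment) and \<open>\<Sum> w v * y\<^sub>v ^ k\<close> (on a vertical one) vanish for
\<open>k \<le> 2\<close> (lemma \<open>spline_of_in_space\<close>). The key point there is that a grid segment never enters the interior
of a cell: a horizontal segment on a level strictly between the lower and the upper side of a cell lies wholly to the
left or wholly to the right of the cell, so that on the cell its terms either add up to zero or all vanish.

Let \<open>N\<close> be the number of maximal grid segments, the four sides of the region among them. There are \<open>3 N\<close> moment
equations. Nine of them are redundant: grouping \<open>\<Sum>v\<in>V. w v * x\<^sub>v ^ i * y\<^sub>v ^ j\<close> once by horizontal and once by
vertical segments gives for each \<open>i, j \<le> 2\<close> a relation between the equations, and as an interior vertex provides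
horizontal segments on three different levels, a Vandermonde argument recovers nine horizontal equations from
all the others (lemma \<open>redundant_moments\<close>). So the dimension is at least \<open>card V - 3 N + 9\<close>
(lemma \<open>vertices_le_dim_spline_space\<close>).

It remains to count. Every segment has two ends, no end is a crossing vertex, and only the four corners of the
region are ends of two segments, so \<open>card V \<ge> V\<^sup>+ + 2 N - 4\<close> (lemma \<open>crossing_vertices_le\<close>). All
segments but the four sides are interior l-edges, so \<open>N \<le> E + 4\<close> (lemma \<open>card_ends_le_l_edges\<close>).
Hence the dimension is at least \<open>V\<^sup>+ - N + 5 \<ge> V\<^sup>+ - E + 1\<close>.\<close>

section \<open>Dimension counting\<close>

text \<open>A linear functional cuts the dimension down by at most one: a single vector outside its kernel
spans the rest. The ambient space may be infinite-dimensional, as the space of all functions on the plane is, so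
finite dimension is expressed by a finite set \<open>F\<close> whose span contains \<open>U\<close>.\<close>
lemma (in vector_space) dim_le_dim_functional_kernel:
  assumes U: "subspace U" and F: "U \<subseteq> span F" "finite F"
    and add: "\<And>u v. \<phi> (u + v) = \<phi> u + (\<phi> v :: 'a)"
    and scale: "\<And>k u. \<phi> (scale k u) = k * \<phi> u"
  shows "dim U \<le> dim {u \<in> U. \<phi> u = 0} + 1"
proof (cases "\<forall>u\<in>U. \<phi> u = 0")
  case True
  then have "{u \<in> U. \<phi> u = 0} = U" by auto
  then show ?thesis by simp
next
  case False
  then obtain u0 where u0: "u0 \<in> U" "\<phi> u0 \<noteq> 0" by blast
  let ?W = "{u \<in> U. \<phi> u = 0}"
  obtain B where B: "B \<subseteq> ?W" "independent B" "?W \<subseteq> span B" "card B = dim ?W"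
    by (rule basis_exists)
  have "B \<subseteq> span F" using B(1) F(1) by blast
  then have finB: "finite B" using independent_span_bound[OF F(2) B(2)] by simp
  have neg: "\<phi> (- u) = - \<phi> u" for u
    using scale[of "-1" u] by simp
  have "U \<subseteq> span (insert u0 B)"
  proof
    fix u assume u: "u \<in> U"
    let ?k = "\<phi> u / \<phi> u0"
    have "u - scale ?k u0 \<in> U"
      using U u u0(1) by (intro subspace_diff subspace_scale)
    moreover have "\<phi> (u - scale ?k u0) = 0"
      using add[of u "- scale ?k u0"] u0(2) by (simp add: neg scale)
    ultimately have "u - scale ?k u0 \<in> span B" using B(3) by blast
    then show "u \<in> span (insert u0 B)" unfolding span_insert by blast
  qed
  then have "dim U \<le> card (insert u0 B)"
    using finB by (intro dim_le_card) auto
  also have "\<dots> \<le> card B + 1"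
    using finB by (simp add: card_insert_if)
  finally show ?thesis using B(4) by simp
qed

text \<open>The finite spanning set matters: the dimension of an infinite-dimensional space counts as \<open>0\<close>.\<close>
lemma (in vector_space) card_independent_le_dim:
  assumes "V \<subseteq> span F" "finite F" "B \<subseteq> V" "independent B"
  shows "card B \<le> dim V"
proof -
  obtain B' where B': "B \<subseteq> B'" "B' \<subseteq> V" "independent B'" "V \<subseteq> span B'"
    using maximal_independent_subset_extend[OF assms(3,4)] .
  have "finite B'"
    using independent_span_bound[OF assms(2) B'(3)] B'(2) assms(1) by blast
  then have "card B \<le> card B'" using B'(1) by (rule card_mono)
  also have "\<dots> = dim V" using B' by (intro basis_card_eq_dim)
  finally show ?thesis .
qed

definition supported_on :: "(real \<times> real) set \<Rightarrow> (real \<times> real \<Rightarrow> real) set" where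
  "supported_on V = {w. \<forall>v. v \<notin> V \<longrightarrow> w v = 0}"

definition solutions :: "(real \<times> real) set \<Rightarrow> (real \<times> real \<Rightarrow> real) set \<Rightarrow> (real \<times> real \<Rightarrow> real) set" where
  "solutions V G = {w \<in> supported_on V. \<forall>g\<in>G. (\<Sum>v\<in>V. g v * w v) = 0}"

lemma subspace_solutions: "fun_space.subspace (solutions V G)"
  by (rule fun_space.subspaceI)
     (auto simp: solutions_def supported_on_def fun_scale_def algebra_simps sum.distrib
        sum_distrib_left[symmetric] mult.left_commute)

definition point_mass :: "real \<times> real \<Rightarrow> real \<times> real \<Rightarrow> real" where
  "point_mass v = (\<lambda>u. if u = v then 1 else 0)"

lemma sum_point_masses_apply:
  assumes "finite V"
  shows "(\<Sum>v\<in>V. fun_scale (k v) (point_mass v)) u = (if u \<in> V then k u else 0)"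
proof -
  have "(\<Sum>v\<in>V. fun_scale (k v) (point_mass v)) u = (\<Sum>v\<in>V. k v * point_mass v u)"
    using assms by (induction V rule: finite_induct) (auto simp: fun_scale_def)
  also have "\<dots> = (\<Sum>v\<in>V. if u = v then k v else 0)"
    by (intro sum.cong) (auto simp: point_mass_def)
  finally show ?thesis using assms by simp
qed

lemma supported_on_subset_span:
  assumes "finite V"
  shows "supported_on V \<subseteq> fun_space.span (point_mass ` V)"
proof
  fix w assume w: "w \<in> supported_on V"
  have "w = (\<Sum>v\<in>V. fun_scale (w v) (point_mass v))"
    by (rule ext, subst sum_point_masses_apply[OF assms]) (use w in \<open>auto simp: supported_on_def\<close>)
  also have "\<dots> \<in> fun_space.span (point_mass ` V)"
    by (intro fun_space.span_sum fun_space.span_scale fun_space.span_base) auto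
  finally show "w \<in> fun_space.span (point_mass ` V)" .
qed

lemma inj_point_mass: "inj point_mass"
  by (rule injI) (metis point_mass_def zero_neq_one)

lemma independent_point_masses:
  assumes "finite V"
  shows "fun_space.independent (point_mass ` V)"
proof (rule fun_space.independent_if_scalars_zero)
  show "finite (point_mass ` V)" using assms by simp
  fix k x assume "(\<Sum>x\<in>point_mass ` V. fun_scale (k x) x) = 0" "x \<in> point_mass ` V"
  then obtain v where v: "v \<in> V" "x = point_mass v" by blast
  have "(\<Sum>v\<in>V. fun_scale (k (point_mass v)) (point_mass v)) = 0"
    using \<open>(\<Sum>x\<in>point_mass ` V. fun_scale (k x) x) = 0\<close>
    by (subst (asm) sum.reindex) (auto intro: inj_on_subset[OF inj_point_mass])
  from this[THEN fun_cong, of v] show "k x = 0"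
    unfolding sum_point_masses_apply[OF assms] using v by simp
qed

text \<open>Each equation costs at most one dimension, and without equations the point masses are a basis of
\<open>card V\<close> elements.\<close>
lemma card_le_dim_solutions:
  assumes V: "finite V" and "finite G"
  shows "card V \<le> fun_space.dim (solutions V G) + card G"
  using \<open>finite G\<close>
proof (induction G rule: finite_induct)
  case empty
  have "card (point_mass ` V) \<le> fun_space.dim (solutions V {})"
    using V by (intro fun_space.card_independent_le_dim[OF supported_on_subset_span[OF V, THEN subset_trans[rotated]]]
      independent_point_masses) (auto simp: solutions_def supported_on_def point_mass_def)
  moreover have "card (point_mass ` V) = card V"
    by (intro card_image inj_on_subset[OF inj_point_mass]) auto
  ultimately show ?case by simp
next
  case (insert g G)
  have "fun_space.dim (solutions V G) \<le> fun_space.dim {w \<in> solutions V G. (\<Sum>v\<in>V. g v * w v) = 0} + 1"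
  proof (rule fun_space.dim_le_dim_functional_kernel[OF subspace_solutions])
    show "solutions V G \<subseteq> fun_space.span (point_mass ` V)"
      using supported_on_subset_span[OF V] by (auto simp: solutions_def)
    show "finite (point_mass ` V)" using V by simp
  qed (simp_all add: fun_scale_def algebra_simps sum.distrib sum_distrib_left)
  also have "{w \<in> solutions V G. (\<Sum>v\<in>V. g v * w v) = 0} = solutions V (insert g G)"
    by (auto simp: solutions_def)
  finally show ?case using insert by simp
qed

section \<open>Truncated powers and moments\<close>

definition trunc_sq :: "real \<Rightarrow> real" where
  "trunc_sq t = (max 0 t)^2"

definition spline_of :: "(real \<times> real) set \<Rightarrow> (real \<times> real \<Rightarrow> real) \<Rightarrow> real \<times> real \<Rightarrow> real" where
  "spline_of V w = (\<lambda>z. \<Sum>v\<in>V. w v * trunc_sq (fst z - fst v) * trunc_sq (snd z - snd v))"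

lemma trunc_sq_nonpos: "t \<le> 0 \<Longrightarrow> trunc_sq t = 0"
  and trunc_sq_nonneg: "0 \<le> t \<Longrightarrow> trunc_sq t = t^2"
  by (simp_all add: trunc_sq_def)

lemma trunc_sq_has_derivative: "(trunc_sq has_real_derivative 2 * max 0 t) (at t)"
proof (cases "t = 0")
  case False
  show ?thesis
  proof (cases "t > 0")
    case True
    have "((\<lambda>t. t^2) has_real_derivative 2 * t) (at t)"
      by (auto intro!: derivative_eq_intros)
    then have "(trunc_sq has_real_derivative 2 * t) (at t)"
      by (rule has_field_derivative_transform_within_open[where S = "{0<..}"])
         (use True in \<open>auto simp: trunc_sq_nonneg\<close>)
    then show ?thesis using True by simp
  next
    case neg: False
    have "((\<lambda>t. 0) has_real_derivative 0) (at t)" by simp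
    then have "(trunc_sq has_real_derivative 0) (at t)"
      by (rule has_field_derivative_transform_within_open[where S = "{..<0}"])
         (use False neg in \<open>auto simp: trunc_sq_nonpos\<close>)
    then show ?thesis using neg by simp
  qed
next
  case True
  have "(\<lambda>h. trunc_sq h / h) \<midarrow>0\<rightarrow> 0"
  proof (rule Lim_null_comparison)
    show "\<forall>\<^sub>F h in at 0. norm (trunc_sq h / h) \<le> \<bar>h\<bar>"
      by (rule always_eventually) (auto simp: trunc_sq_def max_def power2_eq_square)
    show "(\<lambda>h::real. \<bar>h\<bar>) \<midarrow>0\<rightarrow> 0"
      using tendsto_rabs[OF tendsto_ident_at, of "0::real" UNIV] by simp
  qed
  then show ?thesis unfolding True DERIV_def by (simp add: trunc_sq_def)
qed

lemma C_class_spline_of: "C_class 1 1 (spline_of V w)"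
proof -
  define \<tau> where "\<tau> i t = (if i = 0 then trunc_sq t else 2 * max 0 t)" for i :: nat and t
  have cont: "continuous_on UNIV (\<lambda>z. \<tau> i (g z))"
    if "continuous_on UNIV g" for i and g :: "real \<times> real \<Rightarrow> real"
    unfolding \<tau>_def trunc_sq_def using that by (cases "i = 0") (auto intro!: continuous_intros)
  have \<tau>_0: "\<tau> 0 = trunc_sq" by (simp add: \<tau>_def fun_eq_iff)
  have deriv: "((\<lambda>s. trunc_sq (s - r)) has_real_derivative \<tau> (Suc 0) (x - r)) (at x)" for r x
    using DERIV_shift[of trunc_sq "2 * max 0 (x - r)" x "- r"] trunc_sq_has_derivative[of "x - r"]
    by (simp add: \<tau>_def)
  show ?thesis
    unfolding C_class_def
    by (rule exI[of _ "\<lambda>i j z. \<Sum>v\<in>V. w v * \<tau> i (fst z - fst v) * \<tau> j (snd z - snd v)"])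
       (auto simp: spline_of_def \<tau>_0 intro!: continuous_intros cont DERIV_sum DERIV_cmult
          DERIV_cmult_right deriv)
qed

lemma linear_spline_of: "Vector_Spaces.linear fun_scale fun_scale (spline_of V)"
  by unfold_locales
     (simp_all add: spline_of_def fun_scale_def fun_eq_iff algebra_simps sum.distrib sum_distrib_left)

text \<open>Among the vertices with nonzero coefficient take one, \<open>p\<close>, with the least coordinate sum.
Slightly to the upper right of \<open>p\<close> every other such vertex has a coordinate beyond the point of evaluation, so
only the term of \<open>p\<close> survives there.\<close>
lemma spline_of_eq_0_imp:
  assumes V: "finite V" and 0: "spline_of V w = 0" and v: "v \<in> V"
  shows "w v = 0"
proof (rule ccontr)
  assume "w v \<noteq> 0"
  define U where "U = {u \<in> V. w u \<noteq> 0}"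
  have U: "finite U" "v \<in> U" using V v \<open>w v \<noteq> 0\<close> by (auto simp: U_def)
  obtain p where p: "p \<in> U" "\<And>u. u \<in> U \<Longrightarrow> fst p + snd p \<le> fst u + snd u"
    using ex_min_if_finite[of "(\<lambda>u. fst u + snd u) ` U"] U(1,2) by (metis (no_types, lifting) empty_iff finite_imageI imageE imageI not_less)
  \<comment> \<open>\<open>e\<close> is at most each positive coordinate difference to \<open>p\<close>, so a vertex with a larger
     coordinate than \<open>p\<close> is not passed.\<close>
  define D where "D = {d. 0 < d \<and> (\<exists>u\<in>V. d = fst u - fst p \<or> d = snd u - snd p)}"
  have "D \<subseteq> (\<lambda>u. fst u - fst p) ` V \<union> (\<lambda>u. snd u - snd p) ` V" by (auto simp: D_def)
  then have "finite D" using V by (auto intro: finite_subset)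
  define e where "e = Min (insert 1 D)"
  have e: "0 < e" "\<And>d. d \<in> D \<Longrightarrow> e \<le> d"
    using \<open>finite D\<close> by (auto simp: e_def D_def)
  have zero: "w u * trunc_sq (fst p + e - fst u) * trunc_sq (snd p + e - snd u) = 0"
    if u: "u \<in> V" "u \<noteq> p" for u
  proof (cases "w u = 0")
    case False
    with u have "fst p + snd p \<le> fst u + snd u" by (intro p(2)) (simp add: U_def)
    moreover have "fst u \<noteq> fst p \<or> snd u \<noteq> snd p" using u(2) by (simp add: prod_eq_iff)
    ultimately have "0 < fst u - fst p \<or> 0 < snd u - snd p" by linarith
    then have "fst u - fst p \<in> D \<or> snd u - snd p \<in> D" using u(1) by (auto simp: D_def)
    then have "fst p + e - fst u \<le> 0 \<or> snd p + e - snd u \<le> 0" using e(2) by fastforce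
    then show ?thesis by (auto simp: trunc_sq_nonpos)
  qed auto
  have "spline_of V w (fst p + e, snd p + e) =
      (\<Sum>u\<in>V. if u = p then w p * trunc_sq e * trunc_sq e else 0)"
    unfolding spline_of_def by (intro sum.cong) (auto simp: zero)
  also have "\<dots> = w p * e^2 * e^2"
    using V p(1) e(1) by (simp add: U_def trunc_sq_nonneg)
  finally have "w p * e^2 * e^2 = 0" using 0 by simp
  then show False using p(1) e(1) by (simp add: U_def)
qed

lemma inj_on_spline_of:
  assumes "finite V"
  shows "inj_on (spline_of V) (supported_on V)"
proof (rule inj_onI)
  fix w w' assume w: "w \<in> supported_on V" "w' \<in> supported_on V" and eq: "spline_of V w = spline_of V w'"
  interpret Vector_Spaces.linear fun_scale fun_scale "spline_of V" by (rule linear_spline_of)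
  have "spline_of V (w - w') = 0" unfolding diff using eq by simp
  from spline_of_eq_0_imp[OF assms this] have "w v = w' v" if "v \<in> V" for v using that by simp
  then show "w = w'" using w by (intro ext) (case_tac "x \<in> V", auto simp: supported_on_def)
qed

lemma biquadratic_sum:
  fixes w :: "real \<times> real \<Rightarrow> real"
  shows "\<exists>c. \<forall>x y. (\<Sum>v\<in>U. w v * (x - fst v)^2 * (y - snd v)^2) = (\<Sum>i\<le>2. \<Sum>j\<le>2. c i j * x ^ i * y ^ (j::nat))"
proof -
  define q where "q t i = (if i = 0 then t^2 else if i = 1 then - 2 * t else 1)" for t :: real and i :: nat
  have q: "(s - t)^2 = (\<Sum>i\<le>2. q t i * s ^ i)" for s t
    by (simp add: q_def numeral_2_eq_2 algebra_simps power2_eq_square)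
  have "(\<Sum>v\<in>U. w v * (x - fst v)^2 * (y - snd v)^2) =
      (\<Sum>i\<le>2. \<Sum>j\<le>2. (\<Sum>v\<in>U. w v * q (fst v) i * q (snd v) j) * x ^ i * y ^ (j::nat))" for x y
  proof -
    have "(\<Sum>v\<in>U. w v * (x - fst v)^2 * (y - snd v)^2) =
        (\<Sum>v\<in>U. \<Sum>i\<le>2. \<Sum>j\<le>2. w v * q (fst v) i * q (snd v) j * x ^ i * y ^ j)"
      unfolding q mult.assoc sum_product unfolding sum_distrib_left
      by (intro sum.cong refl) (simp only: mult_ac)
    also have "\<dots> = (\<Sum>i\<le>2. \<Sum>v\<in>U. \<Sum>j\<le>2. w v * q (fst v) i * q (snd v) j * x ^ i * y ^ j)"
      by (rule sum.swap)
    also have "\<dots> = (\<Sum>i\<le>2. \<Sum>j\<le>2. \<Sum>v\<in>U. w v * q (fst v) i * q (snd v) j * x ^ i * y ^ j)"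
      by (intro sum.cong refl sum.swap)
    finally show ?thesis by (simp only: sum_distrib_right)
  qed
  then show ?thesis
    by (intro exI[of _ "\<lambda>i j. \<Sum>v\<in>U. w v * q (fst v) i * q (snd v) j"] allI)
qed

text \<open>This is the mechanism by which vanishing moments produce splines. The map \<open>\<kappa>\<close> sends a vertex to
its grid segment, \<open>X\<close> is the coordinate along the segments, and \<open>\<phi>\<close> depends on the segment only. On each segment the
sum is a combination of its first three moments, and \<open>U\<close> consists of whole segments.\<close>
lemma saturated_sum_eq_0:
  fixes X :: "'v \<Rightarrow> real"
  assumes V: "finite V" and U: "U \<subseteq> V"
    and sat: "\<And>u v. u \<in> U \<Longrightarrow> v \<in> V \<Longrightarrow> \<kappa> u = \<kappa> v \<Longrightarrow> v \<in> U"
    and \<phi>: "\<And>u v. u \<in> V \<Longrightarrow> v \<in> V \<Longrightarrow> \<kappa> u = \<kappa> v \<Longrightarrow> \<phi> u = (\<phi> v :: real)"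
    and mom: "\<And>u k. u \<in> V \<Longrightarrow> k \<le> (2::nat) \<Longrightarrow> (\<Sum>v\<in>{v\<in>V. \<kappa> v = \<kappa> u}. w v * X v ^ k) = 0"
  shows "(\<Sum>v\<in>U. w v * (x - X v)^2 * \<phi> v) = 0"
proof -
  have "(\<Sum>v\<in>U. w v * (x - X v)^2 * \<phi> v) =
      (\<Sum>p\<in>\<kappa> ` U. \<Sum>v\<in>{v\<in>U. \<kappa> v = p}. w v * (x - X v)^2 * \<phi> v)"
    using finite_subset[OF U V] by (rule sum.image_gen)
  also have "\<dots> = 0"
  proof (rule sum.neutral, rule ballI)
    fix p assume "p \<in> \<kappa> ` U"
    then obtain u where u: "u \<in> U" "p = \<kappa> u" by blast
    have "{v\<in>U. \<kappa> v = p} = {v\<in>V. \<kappa> v = \<kappa> u}" using u U sat[OF u(1)] by auto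
    then have "(\<Sum>v\<in>{v\<in>U. \<kappa> v = p}. w v * (x - X v)^2 * \<phi> v) =
      (\<Sum>v\<in>{v\<in>V. \<kappa> v = \<kappa> u}. \<phi> u * (x^2 * (w v * X v ^ 0) - 2 * x * (w v * X v ^ 1) + w v * X v ^ 2))"
      using \<phi>[of u] u U by (intro sum.cong) (auto simp: power2_eq_square algebra_simps)
    also have "\<dots> = \<phi> u * (x^2 * (\<Sum>v\<in>{v\<in>V. \<kappa> v = \<kappa> u}. w v * X v ^ 0)
        - 2 * x * (\<Sum>v\<in>{v\<in>V. \<kappa> v = \<kappa> u}. w v * X v ^ 1) + (\<Sum>v\<in>{v\<in>V. \<kappa> v = \<kappa> u}. w v * X v ^ 2))"
      by (simp only: sum_distrib_left[symmetric] sum.distrib sum_subtractf)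
    also have "\<dots> = 0" using mom[of u 0] mom[of u 1] mom[of u 2] u U by auto
    finally show "(\<Sum>v\<in>{v\<in>U. \<kappa> v = p}. w v * (x - X v)^2 * \<phi> v) = 0" .
  qed
  finally show ?thesis .
qed

lemma vandermonde3:
  fixes z1 z2 z3 y1 y2 y3 :: real
  assumes "y1 \<noteq> y2" "y1 \<noteq> y3" "y2 \<noteq> y3"
    and m: "\<And>j. j \<le> (2::nat) \<Longrightarrow> y1^j * z1 + y2^j * z2 + y3^j * z3 = 0"
  shows "z1 = 0" "z2 = 0" "z3 = 0"
proof -
  have e: "z1 + z2 + z3 = 0" "y1 * z1 + y2 * z2 + y3 * z3 = 0" "y1^2 * z1 + y2^2 * z2 + y3^2 * z3 = 0"
    using m[of 0] m[of 1] m[of 2] by simp_all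
  have "(y1 - y2) * (y1 - y3) * z1 = 0" "(y2 - y1) * (y2 - y3) * z2 = 0" "(y3 - y1) * (y3 - y2) * z3 = 0"
    using e by algebra+
  then show "z1 = 0" "z2 = 0" "z3 = 0" using assms(1-3) by auto
qed

section \<open>Rectangular partitions and the ends of their grid segments\<close>

text \<open>A regular T-mesh in coordinates: the cell \<open>i\<close> is \<open>[a i, b i] \<times> [c i, d i]\<close> and the region is
\<open>[A, B] \<times> [C, D]\<close>. Stating the partition by numbers makes its symmetries available as interpretations:
exchanging the axes turns vertical into horizontal grid segments, and negating the abscissa turns right ends into left
ends.\<close>
locale rect_partition =
  fixes I :: "'i set" and a b c d :: "'i \<Rightarrow> real" and A B C D :: real
  assumes finite_I: "finite I"
    and ab: "i \<in> I \<Longrightarrow> a i < b i"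
    and cd: "i \<in> I \<Longrightarrow> c i < d i"
    and disjoint: "i \<in> I \<Longrightarrow> j \<in> I \<Longrightarrow> i \<noteq> j \<Longrightarrow> b i \<le> a j \<or> b j \<le> a i \<or> d i \<le> c j \<or> d j \<le> c i"
    and cover: "(\<exists>i\<in>I. a i \<le> x \<and> x \<le> b i \<and> c i \<le> y \<and> y \<le> d i) \<longleftrightarrow> A \<le> x \<and> x \<le> B \<and> C \<le> y \<and> y \<le> D"
    and AB: "A < B" and CD: "C < D"
begin

definition vtx :: "real \<Rightarrow> real \<Rightarrow> bool" where
  "vtx x y \<longleftrightarrow> (\<exists>i\<in>I. (x = a i \<or> x = b i) \<and> (y = c i \<or> y = d i))"

definition hline :: "real \<Rightarrow> real \<Rightarrow> bool" where
  "hline x y \<longleftrightarrow> (\<exists>i\<in>I. (y = c i \<or> y = d i) \<and> a i \<le> x \<and> x \<le> b i)"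

lemma hlineI: "i \<in> I \<Longrightarrow> y = c i \<or> y = d i \<Longrightarrow> a i \<le> x \<Longrightarrow> x \<le> b i \<Longrightarrow> hline x y"
  unfolding hline_def by blast

text \<open>A maximal horizontal grid segment starts at a vertex from which no cell side continues to the left. This
vertex represents the segment, so that no connected components have to be formed.\<close>
definition left_covered :: "real \<Rightarrow> real \<Rightarrow> bool" where
  "left_covered x y \<longleftrightarrow> (\<exists>i\<in>I. (y = c i \<or> y = d i) \<and> a i < x \<and> x \<le> b i)"

definition right_covered :: "real \<Rightarrow> real \<Rightarrow> bool" where
  "right_covered x y \<longleftrightarrow> (\<exists>i\<in>I. (y = c i \<or> y = d i) \<and> a i \<le> x \<and> x < b i)"

definition left_end :: "real \<Rightarrow> real \<Rightarrow> bool" where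
  "left_end x y \<longleftrightarrow> vtx x y \<and> \<not> left_covered x y"

definition right_end :: "real \<Rightarrow> real \<Rightarrow> bool" where
  "right_end x y \<longleftrightarrow> vtx x y \<and> \<not> right_covered x y"

text \<open>Restricting to abscissae of vertices makes the set finite. No generality is lost, since the maximal segment through
\<open>(x, y)\<close> starts at a vertex.\<close>
definition left_set :: "real \<Rightarrow> real \<Rightarrow> real set" where
  "left_set x y = {t. vtx t y \<and> t \<le> x \<and> (\<forall>s\<in>{t..x}. hline s y)}"

definition leftmost :: "real \<Rightarrow> real \<Rightarrow> real" where
  "leftmost x y = Min (left_set x y)"

lemma transpose: "rect_partition I c d a b C D A B"
proof
  fix x y
  show "(\<exists>i\<in>I. c i \<le> x \<and> x \<le> d i \<and> a i \<le> y \<and> y \<le> b i) = (C \<le> x \<and> x \<le> D \<and> A \<le> y \<and> y \<le> B)"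
    using cover[of y x] by blast
qed (use finite_I ab cd disjoint AB CD in blast)+

lemma reflect: "rect_partition I (\<lambda>i. - b i) (\<lambda>i. - a i) c d (- B) (- A) C D"
proof
  fix x y
  have eq: "(- b i \<le> x \<and> x \<le> - a i) = (a i \<le> - x \<and> - x \<le> b i)" for i by auto
  show "(\<exists>i\<in>I. - b i \<le> x \<and> x \<le> - a i \<and> c i \<le> y \<and> y \<le> d i) = (- B \<le> x \<and> x \<le> - A \<and> C \<le> y \<and> y \<le> D)"
    using cover[of "- x" y] eq by fastforce
next
  fix i j assume "i \<in> I" "j \<in> I" "i \<noteq> j"
  then show "- a i \<le> - b j \<or> - a j \<le> - b i \<or> d i \<le> c j \<or> d j \<le> c i"
    using disjoint[of i j] by auto
qed (use finite_I ab cd AB CD in auto)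

lemma open_box_unique:
  assumes "i \<in> I" "j \<in> I" "a i < x" "x < b i" "c i < y" "y < d i" "a j \<le> x" "x \<le> b j" "c j \<le> y" "y \<le> d j"
  shows "i = j"
  using disjoint[of i j] assms by fastforce

lemma bounds:
  assumes "i \<in> I"
  shows "A \<le> a i" "b i \<le> B" "C \<le> c i" "d i \<le> D"
  using cover[of "a i" "c i"] cover[of "b i" "d i"] ab[OF assms] cd[OF assms] assms
  by (metis order.refl order_less_imp_le)+

lemma hline_open_box:
  assumes "i \<in> I" "hline x y" "a i < x" "x < b i" "c i < y"
  shows "d i \<le> y"
proof (rule ccontr)
  assume "\<not> d i \<le> y"
  obtain j where j: "j \<in> I" "y = c j \<or> y = d j" "a j \<le> x" "x \<le> b j"
    using assms(2) by (auto simp: hline_def)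
  then have "i = j" using assms \<open>\<not> d i \<le> y\<close> cd[of j] by (intro open_box_unique[of i j x y]) auto
  then show False using j assms \<open>\<not> d i \<le> y\<close> by auto
qed

lemma vtx_hline: "vtx x y \<Longrightarrow> hline x y"
  unfolding vtx_def hline_def using ab by force

lemma vtx_bounds: "vtx x y \<Longrightarrow> A \<le> x \<and> x \<le> B \<and> C \<le> y \<and> y \<le> D"
  unfolding vtx_def using bounds ab cd by (metis order.trans order_less_imp_le)

lemma finite_vtx: "finite {(x, y). vtx x y}"
proof -
  have "{(x, y). vtx x y} \<subseteq> (a ` I \<union> b ` I) \<times> (c ` I \<union> d ` I)" by (auto simp: vtx_def)
  then show ?thesis by (rule finite_subset) (use finite_I in auto)
qed

text \<open>As there are finitely many cells, just to the left of \<open>x\<close> there is a stretch without right cell sides. It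
replaces limit arguments: a cell that covers a point of the stretch extends at least to \<open>x\<close>.\<close>
lemma left_gap:
  assumes "t < x"
  obtains s where "t < s" "s < x" "\<And>i. i \<in> I \<Longrightarrow> s \<le> b i \<Longrightarrow> x \<le> b i"
proof -
  define F where "F = insert t {z \<in> b ` I. z < x}"
  have F: "finite F" "F \<noteq> {}" using finite_I by (auto simp: F_def)
  have m: "Max F < x" using F assms by (auto simp: F_def)
  have le: "z \<le> Max F" if "z \<in> F" for z using F that by simp
  let ?s = "(Max F + x) / 2"
  show thesis
  proof (rule that)
    show "t < ?s" using le[of t] m by (simp add: F_def)
    show "?s < x" using m by simp
    fix i assume i: "i \<in> I"
    show "x \<le> b i" if "?s \<le> b i" using that m i le[of "b i"] by (auto simp: F_def not_le[symmetric])
  qed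
qed

text \<open>The local picture at a left end off the left side of the region: a cell that covers points just to the left of it has no
horizontal side there, hence the left end lies in the relative interior of the right side of this cell.\<close>
lemma left_end_cases:
  assumes "left_end x y"
  shows "x = A \<or> (\<exists>i\<in>I. b i = x \<and> c i < y \<and> y < d i)"
proof (cases "x = A")
  case False
  have v: "vtx x y" "\<not> left_covered x y" using assms by (auto simp: left_end_def)
  then have bd: "A < x" "x \<le> B" "C \<le> y" "y \<le> D" using vtx_bounds False by force+
  obtain s where s: "A < s" "s < x" "\<And>i. i \<in> I \<Longrightarrow> s \<le> b i \<Longrightarrow> x \<le> b i"
    using left_gap[OF bd(1)] by metis
  then obtain i where i: "i \<in> I" "a i \<le> s" "s \<le> b i" "c i \<le> y" "y \<le> d i"
    using cover[of s y] bd by auto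
  then have "x \<le> b i" using s by blast
  have "c i < y" "y < d i"
    using v(2) i s \<open>x \<le> b i\<close> by (force simp: left_covered_def)+
  moreover have "\<not> x < b i"
    using hline_open_box[OF i(1) vtx_hline[OF v(1)]] i s \<open>c i < y\<close> \<open>y < d i\<close> by auto
  ultimately show ?thesis using i(1) \<open>x \<le> b i\<close> by force
qed simp

lemma left_end_gap:
  assumes "left_end x y" "t < x"
  shows "\<exists>s\<in>{t..x}. \<not> hline s y"
proof -
  obtain s where s: "t < s" "s < x" "\<And>i. i \<in> I \<Longrightarrow> s \<le> b i \<Longrightarrow> x \<le> b i"
    using left_gap[OF assms(2)] by metis
  have "\<not> hline s y"
    using assms(1) s by (fastforce simp: left_end_def left_covered_def hline_def)
  then show ?thesis using s by auto
qed

lemma left_set_props: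
  assumes "vtx x y"
  shows "finite (left_set x y)" "x \<in> left_set x y"
proof -
  have "left_set x y \<subseteq> fst ` {(x, y). vtx x y}" by (force simp: left_set_def)
  then show "finite (left_set x y)" using finite_vtx by (meson finite_imageI finite_subset)
  show "x \<in> left_set x y" using assms vtx_hline by (auto simp: left_set_def)
qed

lemma leftmost_in: "vtx x y \<Longrightarrow> leftmost x y \<in> left_set x y"
  unfolding leftmost_def using left_set_props[of x y] by (intro Min_in) auto

lemma leftmost_le: "vtx x y \<Longrightarrow> t \<in> left_set x y \<Longrightarrow> leftmost x y \<le> t"
  unfolding leftmost_def using left_set_props by (intro Min_le) auto

lemma leftmost_left_end:
  assumes "vtx x y"
  shows "left_end (leftmost x y) y"
proof -
  let ?t = "leftmost x y"
  have t: "vtx ?t y" "?t \<le> x" "\<forall>s\<in>{?t..x}. hline s y"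
    using leftmost_in[OF assms] by (auto simp: left_set_def)
  have "\<not> left_covered ?t y"
  proof
    assume "left_covered ?t y"
    then obtain i where i: "i \<in> I" "y = c i \<or> y = d i" "a i < ?t" "?t \<le> b i"
      by (auto simp: left_covered_def)
    have "hline s y" if "s \<in> {a i..x}" for s
    proof (cases "s \<le> ?t")
      case True
      then show ?thesis using i that by (auto simp: hline_def)
    qed (use t that in auto)
    then have "a i \<in> left_set x y"
      using i t by (auto simp: left_set_def vtx_def)
    then show False using leftmost_le[OF assms] i by force
  qed
  then show ?thesis using t by (simp add: left_end_def)
qed

lemma leftmost_of_left_end: "left_end x y \<Longrightarrow> leftmost x y = x"
  using leftmost_in[of x y] left_end_gap[of x y "leftmost x y"]
  by (force simp: left_end_def left_set_def)

lemma leftmost_connected: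
  assumes v: "vtx x y" "vtx x' y" and "x \<le> x'" "\<forall>s\<in>{x..x'}. hline s y"
  shows "leftmost x y = leftmost x' y"
proof (rule antisym)
  have t: "leftmost x y \<in> left_set x y" "leftmost x' y \<in> left_set x' y"
    using v leftmost_in by auto
  have sub: "t \<in> left_set x' y" if "t \<in> left_set x y" for t
  proof -
    have "hline s y" if "s \<in> {t..x'}" for s
      using that \<open>t \<in> left_set x y\<close> assms(4) by (cases "s \<le> x") (auto simp: left_set_def)
    then show ?thesis using that \<open>x \<le> x'\<close> by (auto simp: left_set_def)
  qed
  then show le: "leftmost x' y \<le> leftmost x y" using leftmost_le v t by blast
  have "leftmost x' y \<in> left_set x y"
    using t le \<open>x \<le> x'\<close> by (auto simp: left_set_def)
  then show "leftmost x y \<le> leftmost x' y" using leftmost_le v by blast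
qed

text \<open>A maximal segment on a level strictly between the lower and the upper side of a cell cannot cross the cell, so it
stays on one side of it.\<close>
lemma component_beside_cell:
  assumes "vtx x y" "vtx x' y" "leftmost x y = leftmost x' y"
    and i: "i \<in> I" "c i < y" "y < d i" and "x \<le> a i"
  shows "x' \<le> a i"
proof (rule ccontr)
  assume x': "\<not> x' \<le> a i"
  have p: "leftmost x' y \<le> x" "\<forall>s\<in>{leftmost x' y..x'}. hline s y"
    using leftmost_in[OF assms(1)] leftmost_in[OF assms(2)] assms(3) by (auto simp: left_set_def)
  obtain s where "a i < s" "s < b i" "s \<le> x'"
    using dense[of "a i" "min x' (b i)"] x' ab[OF i(1)] by auto
  moreover from this have "hline s y" using p \<open>x \<le> a i\<close> by auto
  ultimately show False using hline_open_box[OF i(1)] i by force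
qed

lemma left_end_boundary: "left_end x C \<Longrightarrow> x = A" "left_end x D \<Longrightarrow> x = A"
  using left_end_cases[of x C] left_end_cases[of x D] bounds by force+

definition left_ends :: "(real \<times> real) set" where "left_ends = {(x, y). left_end x y}"
definition right_ends :: "(real \<times> real) set" where "right_ends = {(x, y). right_end x y}"

lemma finite_left_ends: "finite left_ends" and finite_right_ends: "finite right_ends"
  by (rule finite_subset[OF _ finite_vtx], auto simp: left_ends_def right_ends_def left_end_def right_end_def)+

lemma left_end_right_covered: "left_end x y \<Longrightarrow> right_covered x y"
  unfolding left_end_def left_covered_def right_covered_def vtx_def using ab by force

lemma right_end_left_covered: "right_end x y \<Longrightarrow> left_covered x y"
  unfolding right_end_def left_covered_def right_covered_def vtx_def using ab by force

end

context rect_partition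
begin

interpretation R: rect_partition I "\<lambda>i. - b i" "\<lambda>i. - a i" c d "- B" "- A" C D
  by (rule reflect)

lemma reflect_vtx: "R.vtx (- x) y = vtx x y"
  and reflect_hline: "R.hline (- x) y = hline x y"
  and reflect_left_covered: "R.left_covered (- x) y = right_covered x y"
  unfolding R.vtx_def vtx_def R.hline_def hline_def R.left_covered_def right_covered_def by fastforce+

lemma reflect_left_end: "R.left_end (- x) y = right_end x y"
  by (simp add: R.left_end_def right_end_def reflect_vtx reflect_left_covered)

lemma right_end_cases: "right_end x y \<Longrightarrow> x = B \<or> (\<exists>i\<in>I. a i = x \<and> c i < y \<and> y < d i)"
  using R.left_end_cases[of "- x" y] by (simp add: reflect_left_end)

lemma ex_right_end:
  assumes "vtx x y"
  shows "\<exists>r\<ge>x. right_end r y \<and> (\<forall>s\<in>{x..r}. hline s y)"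
proof (intro exI conjI)
  let ?r = "- R.leftmost (- x) y"
  have v: "R.vtx (- x) y" using assms by (simp add: reflect_vtx)
  note props = R.leftmost_in[OF v, unfolded R.left_set_def]
  show "x \<le> ?r" using props by simp
  show "right_end ?r y" using R.leftmost_left_end[OF v] reflect_left_end[of ?r y] by simp
  show "\<forall>s\<in>{x..?r}. hline s y"
  proof
    fix s assume "s \<in> {x..?r}"
    then have "R.hline (- s) y" using props by auto
    then show "hline s y" by (simp add: reflect_hline)
  qed
qed

lemma right_end_unique:
  assumes "left_end x y" "left_end x' y" "right_end r y"
    and "x \<le> r" "x' \<le> r" "\<forall>s\<in>{x..r}. hline s y" "\<forall>s\<in>{x'..r}. hline s y"
  shows "x = x'"
  using leftmost_connected[of x y r] leftmost_connected[of x' y r] leftmost_of_left_end[of x y]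
    leftmost_of_left_end[of x' y] assms by (simp add: left_end_def right_end_def)

lemma card_left_ends_le: "card left_ends \<le> card right_ends"
proof -
  have "\<forall>p\<in>left_ends. \<exists>r\<ge>fst p. right_end r (snd p) \<and> (\<forall>s\<in>{fst p..r}. hline s (snd p))"
    by (auto simp: left_ends_def left_end_def intro!: ex_right_end)
  then obtain \<rho> where \<rho>: "\<And>p. p \<in> left_ends \<Longrightarrow>
      fst p \<le> \<rho> p \<and> right_end (\<rho> p) (snd p) \<and> (\<forall>s\<in>{fst p..\<rho> p}. hline s (snd p))"
    by metis
  show ?thesis
  proof (rule card_inj_on_le)
    show "inj_on (\<lambda>p. (\<rho> p, snd p)) left_ends"
    proof (rule inj_onI)
      fix p q assume pq: "p \<in> left_ends" "q \<in> left_ends" "(\<rho> p, snd p) = (\<rho> q, snd q)"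
      then have "fst p = fst q"
        using \<rho>[OF pq(1)] \<rho>[OF pq(2)] by (intro right_end_unique[of _ "snd p" _ "\<rho> p"]) (auto simp: left_ends_def)
      then show "p = q" using pq(3) by (simp add: prod_eq_iff)
    qed
    show "(\<lambda>p. (\<rho> p, snd p)) ` left_ends \<subseteq> right_ends" using \<rho> by (auto simp: right_ends_def)
  qed (rule finite_right_ends)
qed

end

context rect_partition
begin

interpretation T: rect_partition I c d a b C D A B
  by (rule transpose)

lemma transpose_vtx: "T.vtx y x = vtx x y"
  by (auto simp: T.vtx_def vtx_def)

text \<open>There are no L-shaped vertices except the corners of the region: at a horizontal end that is not on the
left or right side of the region, the side of a cell passes vertically through the vertex.\<close>
lemma horizontal_and_vertical_end:
  assumes "left_end x y \<or> right_end x y" "T.left_end y x \<or> T.right_end y x"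
  shows "(x, y) \<in> {A, B} \<times> {C, D}"
proof -
  have not_both: "\<not> (\<exists>i\<in>I. (b i = x \<or> a i = x) \<and> c i < y \<and> y < d i)"
    using assms(2) unfolding T.left_end_def T.right_end_def T.left_covered_def T.right_covered_def
    by force
  then have x: "x = A \<or> x = B" using assms(1) left_end_cases right_end_cases by blast
  have "\<not> (\<exists>i\<in>I. a i < x \<and> x < b i)" using x bounds by force
  then have "y = C \<or> y = D" using assms(2) T.left_end_cases T.right_end_cases by blast
  then show ?thesis using x by auto
qed

text \<open>Maximal segments are counted by their left or lower ends, and each has a second end. In the transposed
partition \<open>T.left_ends\<close> and \<open>T.right_ends\<close> are the lower and upper ends of the vertical segments, with
exchanged coordinates.\<close>
lemma two_card_ends_le:
  "2 * card left_ends + 2 * card T.left_ends \<le>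
   card (left_ends \<union> right_ends \<union> prod.swap ` (T.left_ends \<union> T.right_ends)) + 4"
proof -
  note fin = finite_left_ends finite_right_ends T.finite_left_ends T.finite_right_ends
  have disj: "left_ends \<inter> right_ends = {}"
    using left_end_right_covered by (auto simp: left_ends_def right_ends_def right_end_def)
  have disj': "T.left_ends \<inter> T.right_ends = {}"
    using T.left_end_right_covered by (auto simp: T.left_ends_def T.right_ends_def T.right_end_def)
  let ?H = "left_ends \<union> right_ends" and ?V = "prod.swap ` (T.left_ends \<union> T.right_ends)"
  have H: "card ?H = card left_ends + card right_ends"
    using disj fin by (intro card_Un_disjoint)
  have "card ?V = card (T.left_ends \<union> T.right_ends)"
    by (intro card_image) (auto simp: inj_on_def)
  also have "\<dots> = card T.left_ends + card T.right_ends"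
    using disj' fin by (intro card_Un_disjoint)
  finally have V: "card ?V = card T.left_ends + card T.right_ends" .
  have "?H \<inter> ?V \<subseteq> {A, B} \<times> {C, D}"
  proof
    fix p assume "p \<in> ?H \<inter> ?V"
    then have "(fst p, snd p) \<in> {A, B} \<times> {C, D}"
      by (intro horizontal_and_vertical_end)
         (auto simp: left_ends_def right_ends_def T.left_ends_def T.right_ends_def)
    then show "p \<in> {A, B} \<times> {C, D}" by simp
  qed
  then have "card (?H \<inter> ?V) \<le> card ({A, B} \<times> {C, D})"
    by (intro card_mono) auto
  also have "\<dots> \<le> 4" by (simp add: card_cartesian_product card_insert_if)
  finally have "card (?H \<inter> ?V) \<le> 4" .
  moreover have "card ?H + card ?V = card (?H \<union> ?V) + card (?H \<inter> ?V)"
    using fin by (intro card_Un_Int) auto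
  ultimately show ?thesis
    unfolding H V using card_left_ends_le T.card_left_ends_le by simp
qed

end

section \<open>Edges of a T-mesh by direction\<close>

lemma frontier_rectangle:
  fixes a b c d :: real
  shows "frontier ({a..b} \<times> {c..d}) = {a..b} \<times> {c..d} - {a<..<b} \<times> {c<..<d}"
  by (simp add: frontier_def interior_Times closure_closed closed_Times)

lemma rectangle_eq_iff:
  fixes a b c d :: real
  assumes "a < b" "c < d"
  shows "{a..b} \<times> {c..d} = {a'..b'} \<times> {c'..d'} \<longleftrightarrow> a = a' \<and> b = b' \<and> c = c' \<and> d = d'"
  using assms by (auto simp: times_eq_iff Icc_eq_Icc)

lemma corners_rectangle:
  assumes "a < b" "c < d"
  shows "corners ({a..b} \<times> {c..d}) = {a, b} \<times> {c, d}"
  unfolding corners_def using assms rectangle_eq_iff[OF assms] by auto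

lemma closed_segment_ray:
  fixes v \<delta> :: "'a::real_vector"
  assumes "s \<le> t"
  shows "closed_segment (v + s *\<^sub>R \<delta>) (v + t *\<^sub>R \<delta>) = (\<lambda>r. v + r *\<^sub>R \<delta>) ` {s..t}"
proof -
  have "closed_segment (v + s *\<^sub>R \<delta>) (v + t *\<^sub>R \<delta>) = (\<lambda>u. v + u *\<^sub>R \<delta>) ` closed_segment s t"
    unfolding closed_segment_translation
    by (subst closed_segment_linear_image[of "\<lambda>u. u *\<^sub>R \<delta>"]) (simp_all add: linear_scaleR_left image_image)
  then show ?thesis using assms by (simp add: closed_segment_eq_real_ivl)
qed

lemma open_segment_ray:
  fixes v \<delta> :: "'a::real_vector"
  assumes "s < t" "\<delta> \<noteq> 0"
  shows "open_segment (v + s *\<^sub>R \<delta>) (v + t *\<^sub>R \<delta>) = (\<lambda>r. v + r *\<^sub>R \<delta>) ` {s<..<t}"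
proof -
  have "inj (\<lambda>r. v + r *\<^sub>R \<delta>)" using assms(2) by (auto simp: inj_on_def)
  then have "(\<lambda>r. v + r *\<^sub>R \<delta>) ` ({s..t} - {s, t}) =
      (\<lambda>r. v + r *\<^sub>R \<delta>) ` {s..t} - (\<lambda>r. v + r *\<^sub>R \<delta>) ` {s, t}"
    by (rule image_set_diff)
  moreover have "{s..t} - {s, t} = {s<..<t}" by auto
  ultimately show ?thesis
    using closed_segment_ray[of s t v \<delta>] assms(1) by (simp add: open_segment_def)
qed

lemma horizontal_closed_segment: "horizontal (closed_segment p q) \<longleftrightarrow> p \<noteq> q \<and> snd p = snd q"
  unfolding horizontal_def closed_segment_eq doubleton_eq_iff by metis

lemma vertical_closed_segment: "vertical (closed_segment p q) \<longleftrightarrow> p \<noteq> q \<and> fst p = fst q"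
  unfolding vertical_def closed_segment_eq doubleton_eq_iff by metis

definition axis_dirs :: "(real \<times> real) set" where
  "axis_dirs = {(1, 0), (-1, 0), (0, 1), (0, -1)}"

lemma axis_dirs_nonzero: "\<delta> \<in> axis_dirs \<Longrightarrow> \<delta> \<noteq> 0"
  by (auto simp: axis_dirs_def zero_prod_def)

lemma axis_dirs_cases: "\<delta> \<in> axis_dirs \<Longrightarrow> fst \<delta> = 0 \<or> snd \<delta> = 0"
  by (auto simp: axis_dirs_def)

lemma axis_dirs_scale_eq:
  "\<delta> \<in> axis_dirs \<Longrightarrow> \<delta>' \<in> axis_dirs \<Longrightarrow> 0 < s \<Longrightarrow> 0 < s' \<Longrightarrow> s *\<^sub>R \<delta> = s' *\<^sub>R \<delta>' \<Longrightarrow> \<delta> = \<delta>'"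
  by (auto simp: axis_dirs_def)

lemma axis_dir_exists:
  fixes u v :: "real \<times> real"
  assumes "u \<noteq> v" "fst u = fst v \<or> snd u = snd v"
  shows "\<exists>\<delta>\<in>axis_dirs. \<exists>s>0. u = v + s *\<^sub>R \<delta>"
proof -
  have "u = v + (fst u - fst v) *\<^sub>R (1, 0)" "u = v + (fst v - fst u) *\<^sub>R (-1, 0)" if "snd u = snd v"
    using that by (auto simp: prod_eq_iff)
  moreover have "u = v + (snd u - snd v) *\<^sub>R (0, 1)" "u = v + (snd v - snd u) *\<^sub>R (0, -1)" if "fst u = fst v"
    using that by (auto simp: prod_eq_iff)
  moreover have "0 < fst u - fst v \<or> 0 < fst v - fst u" if "snd u = snd v"
    using that assms(1) by (auto simp: prod_eq_iff)
  moreover have "0 < snd u - snd v \<or> 0 < snd v - snd u" if "fst u = fst v"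
    using that assms(1) by (auto simp: prod_eq_iff)
  ultimately show ?thesis using assms(2) unfolding axis_dirs_def by blast
qed

text \<open>For each of the four axis directions this set has at most one element, so the
degree of a vertex is the number of directions with an edge.\<close>
definition ray_edges :: "(real \<times> real) set set \<Rightarrow> real \<times> real \<Rightarrow> real \<times> real \<Rightarrow> (real \<times> real) set set" where
  "ray_edges M \<delta> v = {e \<in> edges M. \<exists>s>0. e = closed_segment v (v + s *\<^sub>R \<delta>)}"

lemma edges_at_eq_ray_edges:
  assumes v: "v \<in> vertices M"
  shows "edges_at M v = (\<Union>\<delta>\<in>axis_dirs. ray_edges M \<delta> v)"
proof
  show "(\<Union>\<delta>\<in>axis_dirs. ray_edges M \<delta> v) \<subseteq> edges_at M v"
    by (auto simp: ray_edges_def edges_at_def)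
  show "edges_at M v \<subseteq> (\<Union>\<delta>\<in>axis_dirs. ray_edges M \<delta> v)"
  proof
    fix e assume "e \<in> edges_at M v"
    then have e: "e \<in> edges M" "v \<in> e" by (auto simp: edges_at_def)
    then obtain p q where pq: "e = closed_segment p q" "p \<noteq> q" "horizontal e \<or> vertical e"
      "open_segment p q \<inter> vertices M = {}"
      by (auto simp: edges_def)
    have "v \<in> {p, q}" using v e pq by (auto simp: open_segment_def)
    then obtain u where u: "e = closed_segment v u" "u \<noteq> v"
      using pq closed_segment_commute by blast
    then have "fst u = fst v \<or> snd u = snd v"
      using pq(3) by (auto simp: horizontal_closed_segment vertical_closed_segment)
    then obtain \<delta> s where "\<delta> \<in> axis_dirs" "0 < s" "u = v + s *\<^sub>R \<delta>"
      using axis_dir_exists u(2) by blast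
    then show "e \<in> (\<Union>\<delta>\<in>axis_dirs. ray_edges M \<delta> v)"
      using u(1) e(1) by (auto simp: ray_edges_def)
  qed
qed

lemma edgeI:
  assumes "p \<in> vertices M" "q \<in> vertices M" "p \<noteq> q" "snd p = snd q \<or> fst p = fst q"
    and "closed_segment p q \<subseteq> (\<Union>K\<in>M. frontier K)" "open_segment p q \<inter> vertices M = {}"
  shows "closed_segment p q \<in> edges M"
proof -
  have "horizontal (closed_segment p q) \<or> vertical (closed_segment p q)"
    using assms(3,4) by (simp add: horizontal_closed_segment vertical_closed_segment)
  then show ?thesis
    unfolding edges_def mem_Collect_eq using assms by (intro exI[of _ p] exI[of _ q] conjI refl)
qed

lemma edge_subset_grid: "e \<in> edges M \<Longrightarrow> e \<subseteq> (\<Union>K\<in>M. frontier K)"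
  unfolding edges_def by blast

lemma edge_endpoint_vertices:
  assumes "closed_segment p q \<in> edges M"
  shows "p \<in> vertices M" "q \<in> vertices M" "open_segment p q \<inter> vertices M = {}"
  using assms by (auto simp: edges_def doubleton_eq_iff open_segment_commute)

lemma ray_edges_unique:
  assumes \<delta>: "\<delta> \<noteq> 0" and e: "e \<in> ray_edges M \<delta> v" "e' \<in> ray_edges M \<delta> v"
  shows "e = e'"
proof -
  obtain s s' where s: "0 < s" "e = closed_segment v (v + s *\<^sub>R \<delta>)" "0 < s'" "e' = closed_segment v (v + s' *\<^sub>R \<delta>)"
    using e by (auto simp: ray_edges_def)
  have no: "\<not> r < t"
    if "0 < r" "closed_segment v (v + r *\<^sub>R \<delta>) \<in> edges M" "closed_segment v (v + t *\<^sub>R \<delta>) \<in> edges M" for r t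
  proof
    assume "r < t"
    then have "v + r *\<^sub>R \<delta> \<in> open_segment v (v + t *\<^sub>R \<delta>)"
      using open_segment_ray[of 0 t \<delta> v] \<delta> \<open>0 < r\<close> by auto
    then show False using edge_endpoint_vertices that(2,3) by blast
  qed
  have "s = s'" using no[of s s'] no[of s' s] s e by (auto simp: ray_edges_def)
  then show ?thesis using s by simp
qed

lemma card_ray_edges:
  assumes "\<delta> \<noteq> 0" "ray_edges M \<delta> v \<noteq> {}"
  shows "card (ray_edges M \<delta> v) = 1"
  using ray_edges_unique[OF assms(1)] assms(2) by (metis is_singletonI' is_singleton_altdef)

lemma finite_ray_edges: "\<delta> \<noteq> 0 \<Longrightarrow> finite (ray_edges M \<delta> v)"
  by (metis card_ray_edges card.infinite finite.emptyI zero_neq_one)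

lemma ray_edges_disjoint:
  assumes "\<delta> \<in> axis_dirs" "\<delta>' \<in> axis_dirs" "\<delta> \<noteq> \<delta>'"
  shows "ray_edges M \<delta> v \<inter> ray_edges M \<delta>' v = {}"
proof -
  have False if "0 < s" "0 < s'" "closed_segment v (v + s *\<^sub>R \<delta>) = closed_segment v (v + s' *\<^sub>R \<delta>')" for s s'
    using that axis_dirs_scale_eq[of \<delta> \<delta>' s s'] assms by (auto simp: doubleton_eq_iff)
  then show ?thesis unfolding ray_edges_def by blast
qed

lemma card_Union_ray_edges:
  assumes "\<Delta> \<subseteq> axis_dirs"
  shows "card (\<Union>\<delta>\<in>\<Delta>. ray_edges M \<delta> v) = card {\<delta>\<in>\<Delta>. ray_edges M \<delta> v \<noteq> {}}"
proof -
  have fin: "finite \<Delta>" using assms by (rule finite_subset) (simp add: axis_dirs_def)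
  have "\<forall>\<delta>\<in>\<Delta>. \<forall>\<delta>'\<in>\<Delta>. \<delta> \<noteq> \<delta>' \<longrightarrow> ray_edges M \<delta> v \<inter> ray_edges M \<delta>' v = {}"
    using assms ray_edges_disjoint by blast
  moreover have "\<forall>\<delta>\<in>\<Delta>. finite (ray_edges M \<delta> v)"
    using assms axis_dirs_nonzero finite_ray_edges by blast
  ultimately have "card (\<Union>\<delta>\<in>\<Delta>. ray_edges M \<delta> v) = (\<Sum>\<delta>\<in>\<Delta>. card (ray_edges M \<delta> v))"
    by (intro card_UN_disjoint fin)
  also have "\<dots> = (\<Sum>\<delta>\<in>\<Delta>. if ray_edges M \<delta> v \<noteq> {} then 1 else 0)"
    using assms axis_dirs_nonzero card_ray_edges by (intro sum.cong refl) (metis card.empty subsetD)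
  finally show ?thesis using fin by (simp add: sum.If_cases Collect_conj_eq)
qed

lemma horizontal_ray_edge:
  assumes "\<delta> \<in> axis_dirs" "e \<in> ray_edges M \<delta> v"
  shows "horizontal e \<longleftrightarrow> snd \<delta> = 0" "vertical e \<longleftrightarrow> fst \<delta> = 0"
  using assms axis_dirs_nonzero[OF assms(1)]
  by (auto simp: ray_edges_def horizontal_closed_segment vertical_closed_segment)

lemma horizontal_edges_at:
  assumes "v \<in> vertices M"
  shows "{e \<in> edges_at M v. horizontal e} = (\<Union>\<delta>\<in>{(1, 0), (-1, 0)}. ray_edges M \<delta> v)"
proof -
  have "{e \<in> edges_at M v. horizontal e} = (\<Union>\<delta>\<in>axis_dirs. {e \<in> ray_edges M \<delta> v. horizontal e})"
    unfolding edges_at_eq_ray_edges[OF assms] by blast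
  also have "\<dots> = (\<Union>\<delta>\<in>axis_dirs. if snd \<delta> = 0 then ray_edges M \<delta> v else {})"
    by (intro SUP_cong refl) (auto simp: horizontal_ray_edge)
  finally show ?thesis by (simp add: axis_dirs_def)
qed

lemma vertical_edges_at:
  assumes "v \<in> vertices M"
  shows "{e \<in> edges_at M v. vertical e} = (\<Union>\<delta>\<in>{(0, 1), (0, -1)}. ray_edges M \<delta> v)"
proof -
  have "{e \<in> edges_at M v. vertical e} = (\<Union>\<delta>\<in>axis_dirs. {e \<in> ray_edges M \<delta> v. vertical e})"
    unfolding edges_at_eq_ray_edges[OF assms] by blast
  also have "\<dots> = (\<Union>\<delta>\<in>axis_dirs. if fst \<delta> = 0 then ray_edges M \<delta> v else {})"
    by (intro SUP_cong refl) (auto simp: horizontal_ray_edge)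
  finally show ?thesis by (simp add: axis_dirs_def)
qed

text \<open>If exactly one direction has no edge, the opposite edge is the only one on this axis.\<close>
lemma T_vertexI:
  assumes v: "v \<in> interior_vertices M" and \<delta>: "\<delta> \<in> axis_dirs" "ray_edges M \<delta> v = {}"
    and ne: "\<And>\<delta>'. \<delta>' \<in> axis_dirs \<Longrightarrow> \<delta>' \<noteq> \<delta> \<Longrightarrow> ray_edges M \<delta>' v \<noteq> {}"
  shows "snd \<delta> = 0 \<Longrightarrow> v \<in> horizontal_T_vertices M" "fst \<delta> = 0 \<Longrightarrow> v \<in> vertical_T_vertices M"
proof -
  have v': "v \<in> vertices M" using v by (simp add: interior_vertices_def)
  have "{\<delta>'\<in>axis_dirs. ray_edges M \<delta>' v \<noteq> {}} = axis_dirs - {\<delta>}" using \<delta> ne by auto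
  moreover have "card (axis_dirs - {\<delta>}) = 3" using \<delta>(1) by (simp add: axis_dirs_def)
  ultimately have T: "v \<in> T_vertices M"
    using v v' card_Union_ray_edges[of axis_dirs M v] by (simp add: T_vertices_def edges_at_eq_ray_edges)
  show "v \<in> horizontal_T_vertices M" if "snd \<delta> = 0"
  proof -
    have "{\<delta>'\<in>{(1, 0), (-1, 0)}. ray_edges M \<delta>' v \<noteq> {}} = {(1, 0), (-1, 0)} - {\<delta>}"
      using \<delta> ne[unfolded axis_dirs_def] by blast
    moreover have "card ({(1, 0), (-1, 0)} - {\<delta>}) = 1"
      using \<delta>(1) that by (auto simp: axis_dirs_def)
    ultimately have "card {e \<in> edges_at M v. horizontal e} = 1"
      unfolding horizontal_edges_at[OF v']
      by (subst card_Union_ray_edges) (simp_all add: axis_dirs_def)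
    then show ?thesis using T by (simp add: horizontal_T_vertices_def)
  qed
  show "v \<in> vertical_T_vertices M" if "fst \<delta> = 0"
  proof -
    have "{\<delta>'\<in>{(0, 1), (0, -1)}. ray_edges M \<delta>' v \<noteq> {}} = {(0, 1), (0, -1)} - {\<delta>}"
      using \<delta> ne[unfolded axis_dirs_def] by blast
    moreover have "card ({(0, 1), (0, -1)} - {\<delta>}) = 1"
      using \<delta>(1) that by (auto simp: axis_dirs_def)
    ultimately have "card {e \<in> edges_at M v. vertical e} = 1"
      unfolding vertical_edges_at[OF v']
      by (subst card_Union_ray_edges) (simp_all add: axis_dirs_def)
    then show ?thesis using T by (simp add: vertical_T_vertices_def)
  qed
qed

lemma finite_ray_vertices:
  assumes "finite (vertices M)" "\<delta> \<noteq> 0"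
  shows "finite {t. v + t *\<^sub>R \<delta> \<in> vertices M}"
proof -
  have "inj (\<lambda>t. v + t *\<^sub>R \<delta>)" using assms(2) by (auto simp: inj_on_def)
  from finite_vimageI[OF assms(1) this] show ?thesis by (simp add: vimage_def)
qed

text \<open>On a grid segment between two vertices, each point lies on an edge: the one between the next vertices on either
side. At the starting point \<open>r = 0\<close> the edge can be chosen to start there.\<close>
lemma segment_between_consecutive_vertices:
  assumes "finite (vertices M)" and \<delta>: "\<delta> \<in> axis_dirs"
    and l: "0 < l" "v \<in> vertices M" "v + l *\<^sub>R \<delta> \<in> vertices M"
    and grid: "closed_segment v (v + l *\<^sub>R \<delta>) \<subseteq> (\<Union>K\<in>M. frontier K)"
    and r: "0 \<le> r" "r \<le> l"
  obtains s t where "0 \<le> s" "s \<le> r" "r \<le> t" "s < t" "t \<le> l" "r = 0 \<Longrightarrow> s = 0"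
    "closed_segment (v + s *\<^sub>R \<delta>) (v + t *\<^sub>R \<delta>) \<in> edges M"
proof -
  define P where "P = {t. 0 \<le> t \<and> t \<le> l \<and> v + t *\<^sub>R \<delta> \<in> vertices M}"
  have P: "finite P" "0 \<in> P" "l \<in> P"
    using finite_subset[OF _ finite_ray_vertices[OF assms(1) axis_dirs_nonzero[OF \<delta>], of v], of P] l
    by (auto simp: P_def)
  define Q where "Q = {t\<in>P. r \<le> t \<and> 0 < t}"
  have Q: "finite Q" "l \<in> Q" using P l r by (auto simp: Q_def)
  \<comment> \<open>\<open>t\<close> is kept positive so that \<open>s\<close> exists also for \<open>r = 0\<close>.\<close>
  define t where "t = Min Q"
  have "t \<in> Q" unfolding t_def using Q by (intro Min_in) auto
  have t: "t \<in> P" "r \<le> t" "0 < t" "\<And>t'. t' \<in> P \<Longrightarrow> r \<le> t' \<Longrightarrow> 0 < t' \<Longrightarrow> t \<le> t'"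
    using \<open>t \<in> Q\<close> Min_le[OF Q(1)] by (auto simp: Q_def t_def)
  define R where "R = {s\<in>P. s < t}"
  have R: "finite R" "0 \<in> R" using P t(3) by (auto simp: R_def)
  define s where "s = Max R"
  have "s \<in> R" unfolding s_def using R by (intro Max_in) auto
  have s: "s \<in> P" "s < t" "\<And>s'. s' \<in> P \<Longrightarrow> s' < t \<Longrightarrow> s' \<le> s"
    using \<open>s \<in> R\<close> Max_ge[OF R(1)] by (auto simp: R_def s_def)
  have "0 \<le> s" "t \<le> l" using s t by (auto simp: P_def)
  have "s \<le> r" using t(4)[of s] s r by force
  have open_seg: "open_segment (v + s *\<^sub>R \<delta>) (v + t *\<^sub>R \<delta>) = (\<lambda>u. v + u *\<^sub>R \<delta>) ` {s<..<t}"
    using s(2) axis_dirs_nonzero[OF \<delta>] by (rule open_segment_ray)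
  have "open_segment (v + s *\<^sub>R \<delta>) (v + t *\<^sub>R \<delta>) \<inter> vertices M = {}"
  proof -
    have False if "s < u" "u < t" "v + u *\<^sub>R \<delta> \<in> vertices M" for u
      using that s(3)[of u] \<open>0 \<le> s\<close> \<open>t \<le> l\<close> by (auto simp: P_def)
    then show ?thesis unfolding open_seg by auto
  qed
  moreover have "closed_segment (v + s *\<^sub>R \<delta>) (v + t *\<^sub>R \<delta>) \<subseteq> closed_segment v (v + l *\<^sub>R \<delta>)"
    using closed_segment_ray[of s t v \<delta>] closed_segment_ray[of 0 l v \<delta>] s(2) \<open>0 \<le> s\<close> \<open>t \<le> l\<close> by auto
  moreover have "v + s *\<^sub>R \<delta> \<noteq> v + t *\<^sub>R \<delta>" using s(2) axis_dirs_nonzero[OF \<delta>] by simp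
  moreover have "snd (v + s *\<^sub>R \<delta>) = snd (v + t *\<^sub>R \<delta>) \<or> fst (v + s *\<^sub>R \<delta>) = fst (v + t *\<^sub>R \<delta>)"
    using axis_dirs_cases[OF \<delta>] by auto
  moreover have "v + s *\<^sub>R \<delta> \<in> vertices M" "v + t *\<^sub>R \<delta> \<in> vertices M" using s t by (auto simp: P_def)
  ultimately have "closed_segment (v + s *\<^sub>R \<delta>) (v + t *\<^sub>R \<delta>) \<in> edges M"
    using grid by (intro edgeI) auto
  then show thesis
    using \<open>0 \<le> s\<close> \<open>s \<le> r\<close> by (intro that[OF \<open>0 \<le> s\<close> \<open>s \<le> r\<close> t(2) s(2) \<open>t \<le> l\<close>]) simp_all
qed

lemma ray_edges_nonempty:
  assumes "finite (vertices M)" "\<delta> \<in> axis_dirs"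
    and "0 < l" "v \<in> vertices M" "v + l *\<^sub>R \<delta> \<in> vertices M"
    and "closed_segment v (v + l *\<^sub>R \<delta>) \<subseteq> (\<Union>K\<in>M. frontier K)"
  shows "ray_edges M \<delta> v \<noteq> {}"
proof -
  obtain s t where "s < t" "0 = (0::real) \<Longrightarrow> s = 0" "closed_segment (v + s *\<^sub>R \<delta>) (v + t *\<^sub>R \<delta>) \<in> edges M"
    using segment_between_consecutive_vertices[OF assms order_refl less_imp_le[OF assms(3)]] by metis
  then have "closed_segment v (v + t *\<^sub>R \<delta>) \<in> ray_edges M \<delta> v"
    unfolding ray_edges_def by auto
  then show ?thesis by blast
qed

lemma ray_edges_empty:
  assumes "0 < l" "\<And>s. 0 < s \<Longrightarrow> s < l \<Longrightarrow> v + s *\<^sub>R \<delta> \<notin> (\<Union>K\<in>M. frontier K)"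
  shows "ray_edges M \<delta> v = {}"
proof -
  have False if s: "0 < s" "closed_segment v (v + s *\<^sub>R \<delta>) \<in> edges M" for s
  proof -
    have "v + (min s l / 2) *\<^sub>R \<delta> \<in> closed_segment v (v + s *\<^sub>R \<delta>)"
      using closed_segment_ray[of 0 s v \<delta>] s(1) assms(1) by auto
    moreover have "closed_segment v (v + s *\<^sub>R \<delta>) \<subseteq> (\<Union>K\<in>M. frontier K)"
      using s(2) by (rule edge_subset_grid)
    ultimately show False using assms(2)[of "min s l / 2"] assms(1) s(1) by auto
  qed
  then show ?thesis by (auto simp: ray_edges_def)
qed

lemma segment_eq_Union_interior_edges:
  assumes "finite (vertices M)" and \<delta>: "\<delta> \<in> axis_dirs"
    and l: "0 < l" "v \<in> vertices M" "v + l *\<^sub>R \<delta> \<in> vertices M"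
    and grid: "closed_segment v (v + l *\<^sub>R \<delta>) \<subseteq> (\<Union>K\<in>M. frontier K)"
    and interior: "open_segment v (v + l *\<^sub>R \<delta>) \<inter> frontier (region M) = {}"
  shows "\<exists>H. H \<subseteq> interior_edges M \<and> (\<forall>e\<in>H. \<exists>s t. s < t \<and> e = closed_segment (v + s *\<^sub>R \<delta>) (v + t *\<^sub>R \<delta>)) \<and>
    closed_segment v (v + l *\<^sub>R \<delta>) = \<Union>H"
proof -
  define S where "S s t = closed_segment (v + s *\<^sub>R \<delta>) (v + t *\<^sub>R \<delta>)" for s t
  have S: "S s t = (\<lambda>r. v + r *\<^sub>R \<delta>) ` {s..t}" if "s < t" for s t
    unfolding S_def using that by (intro closed_segment_ray) simp
  define H where "H = {S s t | s t. 0 \<le> s \<and> s < t \<and> t \<le> l \<and> S s t \<in> edges M}"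
  have seg: "closed_segment v (v + l *\<^sub>R \<delta>) = (\<lambda>r. v + r *\<^sub>R \<delta>) ` {0..l}"
    using closed_segment_ray[of 0 l v \<delta>] l(1) by simp
  have "e \<in> interior_edges M" if "e \<in> H" for e
  proof -
    obtain s t where st: "0 \<le> s" "s < t" "t \<le> l" "e = S s t" "e \<in> edges M"
      using \<open>e \<in> H\<close> unfolding H_def by auto
    have "v + ((s + t) / 2) *\<^sub>R \<delta> \<in> e"
      using S[of s t] st by auto
    moreover have "v + ((s + t) / 2) *\<^sub>R \<delta> \<in> open_segment v (v + l *\<^sub>R \<delta>)"
      using open_segment_ray[of 0 l \<delta> v] l(1) st axis_dirs_nonzero[OF \<delta>] by auto
    ultimately show ?thesis using interior st(5) by (auto simp: interior_edges_def)
  qed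
  moreover have "closed_segment v (v + l *\<^sub>R \<delta>) = \<Union>H"
  proof
    show "\<Union>H \<subseteq> closed_segment v (v + l *\<^sub>R \<delta>)"
    proof
      fix z assume "z \<in> \<Union>H"
      then obtain s t where st: "0 \<le> s" "s < t" "t \<le> l" "z \<in> S s t"
        unfolding H_def by blast
      then show "z \<in> closed_segment v (v + l *\<^sub>R \<delta>)"
        unfolding seg using S[of s t] st by auto
    qed
    show "closed_segment v (v + l *\<^sub>R \<delta>) \<subseteq> \<Union>H"
    proof
      fix z assume "z \<in> closed_segment v (v + l *\<^sub>R \<delta>)"
      then obtain r where "z = v + r *\<^sub>R \<delta>" "r \<in> {0..l}" unfolding seg by (rule imageE)
      then have r: "z = v + r *\<^sub>R \<delta>" "0 \<le> r" "r \<le> l" by simp_all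
      obtain s t where st: "0 \<le> s" "s \<le> r" "r \<le> t" "s < t" "t \<le> l"
          "S s t \<in> edges M"
        by (rule segment_between_consecutive_vertices[OF assms(1) \<delta> l grid r(2,3), folded S_def])
      then have "S s t \<in> H" unfolding H_def by blast
      moreover have "z \<in> S s t"
        using S[of s t] st r by auto
      ultimately show "z \<in> \<Union>H" by blast
    qed
  qed
  moreover have "\<forall>e\<in>H. \<exists>s t. s < t \<and> e = S s t"
    unfolding H_def by blast
  ultimately show ?thesis unfolding S_def by blast
qed

section \<open>Vertices, edges and l-edges in coordinates\<close>

locale mesh_coords = rect_partition M a b c d A B C D
  for M :: "(real \<times> real) set set" and a b c d :: "(real \<times> real) set \<Rightarrow> real" and A B C D :: real +
  assumes cell: "K \<in> M \<Longrightarrow> K = {a K..b K} \<times> {c K..d K}"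
begin

lemma mem_cell: "K \<in> M \<Longrightarrow> (x, y) \<in> K \<longleftrightarrow> a K \<le> x \<and> x \<le> b K \<and> c K \<le> y \<and> y \<le> d K"
  using cell by (metis atLeastAtMost_iff mem_Sigma_iff)

lemma region_eq: "region M = {A..B} \<times> {C..D}"
proof -
  have "(x, y) \<in> region M \<longleftrightarrow> (x, y) \<in> {A..B} \<times> {C..D}" for x y
    unfolding region_def using cover[of x y] mem_cell by auto
  then show ?thesis by auto
qed

lemma frontier_cell: "K \<in> M \<Longrightarrow> frontier K = {a K..b K} \<times> {c K..d K} - {a K<..<b K} \<times> {c K<..<d K}"
  using cell frontier_rectangle by metis

lemma mem_vertices: "(x, y) \<in> vertices M \<longleftrightarrow> vtx x y"
proof -
  have "corners K = {a K, b K} \<times> {c K, d K}" if "K \<in> M" for K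
    using corners_rectangle[OF ab[OF that] cd[OF that]] cell[OF that] by simp
  then show ?thesis unfolding vertices_def vtx_def by auto
qed

lemma vertices_eq: "vertices M = {(x, y). vtx x y}"
  using mem_vertices by auto

lemma finite_vertices: "finite (vertices M)"
  unfolding vertices_eq by (rule finite_vtx)

lemma hline_grid: "hline x y \<Longrightarrow> (x, y) \<in> (\<Union>K\<in>M. frontier K)"
proof -
  assume "hline x y"
  then obtain K where K: "K \<in> M" "y = c K \<or> y = d K" "a K \<le> x" "x \<le> b K" by (auto simp: hline_def)
  then have "(x, y) \<in> frontier K" unfolding frontier_cell[OF K(1)] using cd[OF K(1)] by auto
  then show ?thesis using K(1) by blast
qed

lemma cell_interior_not_grid:
  assumes "K \<in> M" "a K < x" "x < b K" "c K < y" "y < d K"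
  shows "(x, y) \<notin> (\<Union>K\<in>M. frontier K)"
proof
  assume "(x, y) \<in> (\<Union>K\<in>M. frontier K)"
  then obtain L where L: "L \<in> M" "(x, y) \<in> frontier L" by blast
  then have L': "a L \<le> x" "x \<le> b L" "c L \<le> y" "y \<le> d L"
      "\<not> (a L < x \<and> x < b L \<and> c L < y \<and> y < d L)"
    unfolding frontier_cell[OF L(1)] by simp_all
  then have "K = L" using open_box_unique[of K L x y] assms L by blast
  then show False using L' assms by simp
qed

interpretation T: rect_partition M c d a b C D A B
  by (rule transpose)

lemma vline_grid: "T.hline y x \<Longrightarrow> (x, y) \<in> (\<Union>K\<in>M. frontier K)"
proof -
  assume "T.hline y x"
  then obtain K where K: "K \<in> M" "x = a K \<or> x = b K" "c K \<le> y" "y \<le> d K" by (auto simp: T.hline_def)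
  then have "(x, y) \<in> frontier K" unfolding frontier_cell[OF K(1)] using ab[OF K(1)] by auto
  then show ?thesis using K(1) by blast
qed

lemma horizontal_segment_grid:
  assumes "x \<le> x'" "\<forall>s\<in>{x..x'}. hline s y"
  shows "closed_segment (x, y) (x', y) \<subseteq> (\<Union>K\<in>M. frontier K)"
proof
  fix z assume "z \<in> closed_segment (x, y) (x', y)"
  then have "fst z \<in> {x..x'}" "snd z = y"
    using closed_segment_ray[of 0 "x' - x" "(x, y)" "(1, 0)"] assms(1) by auto
  then show "z \<in> (\<Union>K\<in>M. frontier K)"
    using hline_grid[of "fst z" y] assms(2) by (metis prod.collapse)
qed

lemma vertical_segment_grid:
  assumes "y \<le> y'" "\<forall>s\<in>{y..y'}. T.hline s x"
  shows "closed_segment (x, y) (x, y') \<subseteq> (\<Union>K\<in>M. frontier K)"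
proof
  fix z assume "z \<in> closed_segment (x, y) (x, y')"
  then have "snd z \<in> {y..y'}" "fst z = x"
    using closed_segment_ray[of 0 "y' - y" "(x, y)" "(0, 1)"] assms(1) by auto
  then show "z \<in> (\<Union>K\<in>M. frontier K)"
    using vline_grid[of "snd z" x] assms(2) by (metis prod.collapse)
qed

lemma ray_edges_right:
  assumes "vtx x y" "right_covered x y"
  shows "ray_edges M (1, 0) (x, y) \<noteq> {}"
proof -
  obtain K where K: "K \<in> M" "y = c K \<or> y = d K" "a K \<le> x" "x < b K"
    using assms(2) by (auto simp: right_covered_def)
  show ?thesis
  proof (rule ray_edges_nonempty[OF finite_vertices, of _ "b K - x"])
    show "closed_segment (x, y) ((x, y) + (b K - x) *\<^sub>R (1, 0)) \<subseteq> (\<Union>K\<in>M. frontier K)"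
      using horizontal_segment_grid[of x "b K" y] K hlineI[of K] by simp
  qed (use K assms(1) in \<open>auto simp: axis_dirs_def mem_vertices vtx_def\<close>)
qed

lemma ray_edges_left:
  assumes "vtx x y" "left_covered x y"
  shows "ray_edges M (-1, 0) (x, y) \<noteq> {}"
proof -
  obtain K where K: "K \<in> M" "y = c K \<or> y = d K" "a K < x" "x \<le> b K"
    using assms(2) by (auto simp: left_covered_def)
  show ?thesis
  proof (rule ray_edges_nonempty[OF finite_vertices, of _ "x - a K"])
    have "closed_segment (a K, y) (x, y) \<subseteq> (\<Union>K\<in>M. frontier K)"
      using horizontal_segment_grid[of "a K" x y] K hlineI[of K] by simp
    then show "closed_segment (x, y) ((x, y) + (x - a K) *\<^sub>R (-1, 0)) \<subseteq> (\<Union>K\<in>M. frontier K)"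
      by (simp add: closed_segment_commute)
  qed (use K assms(1) in \<open>auto simp: axis_dirs_def mem_vertices vtx_def\<close>)
qed

lemma ray_edges_up:
  assumes "vtx x y" "T.right_covered y x"
  shows "ray_edges M (0, 1) (x, y) \<noteq> {}"
proof -
  obtain K where K: "K \<in> M" "x = a K \<or> x = b K" "c K \<le> y" "y < d K"
    using assms(2) by (auto simp: T.right_covered_def)
  show ?thesis
  proof (rule ray_edges_nonempty[OF finite_vertices, of _ "d K - y"])
    show "closed_segment (x, y) ((x, y) + (d K - y) *\<^sub>R (0, 1)) \<subseteq> (\<Union>K\<in>M. frontier K)"
      using vertical_segment_grid[of y "d K" x] K T.hlineI[of K] by simp
  qed (use K assms(1) in \<open>auto simp: axis_dirs_def mem_vertices vtx_def\<close>)
qed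

lemma ray_edges_down:
  assumes "vtx x y" "T.left_covered y x"
  shows "ray_edges M (0, -1) (x, y) \<noteq> {}"
proof -
  obtain K where K: "K \<in> M" "x = a K \<or> x = b K" "c K < y" "y \<le> d K"
    using assms(2) by (auto simp: T.left_covered_def)
  show ?thesis
  proof (rule ray_edges_nonempty[OF finite_vertices, of _ "y - c K"])
    have "closed_segment (x, c K) (x, y) \<subseteq> (\<Union>K\<in>M. frontier K)"
      using vertical_segment_grid[of "c K" y x] K T.hlineI[of K] by simp
    then show "closed_segment (x, y) ((x, y) + (y - c K) *\<^sub>R (0, -1)) \<subseteq> (\<Union>K\<in>M. frontier K)"
      by (simp add: closed_segment_commute)
  qed (use K assms(1) in \<open>auto simp: axis_dirs_def mem_vertices vtx_def\<close>)
qed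

lemma boundary_or_interior_vertex:
  assumes "vtx x y"
  shows "(x, y) \<in> boundary_vertices M \<or> (x, y) \<in> interior_vertices M \<and> A < x \<and> x < B \<and> C < y \<and> y < D"
  using assms vtx_bounds[OF assms] mem_vertices
  unfolding boundary_vertices_def interior_vertices_def region_eq frontier_rectangle by auto

text \<open>At an interior end of a horizontal segment the cell behind the end rules out an edge on that side, and the side
of this cell through the end provides the two vertical edges.\<close>
lemma horizontal_end_vertex:
  assumes "left_end x y \<or> right_end x y"
  shows "(x, y) \<in> boundary_vertices M \<union> horizontal_T_vertices M"
proof -
  have v: "vtx x y" using assms by (auto simp: left_end_def right_end_def)
  have "(x, y) \<in> horizontal_T_vertices M"
    if int: "(x, y) \<in> interior_vertices M" "A < x" "x < B" "C < y" "y < D"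
  proof -
    have vert: "ray_edges M (0, 1) (x, y) \<noteq> {}" "ray_edges M (0, -1) (x, y) \<noteq> {}"
      if "K \<in> M" "x = a K \<or> x = b K" "c K < y" "y < d K" for K
      using ray_edges_up[OF v] ray_edges_down[OF v] that
      by (force simp: T.right_covered_def T.left_covered_def)+
    show ?thesis using assms
    proof
      assume l: "left_end x y"
      then obtain K where K: "K \<in> M" "b K = x" "c K < y" "y < d K" using left_end_cases int by force
      have none: "ray_edges M (-1, 0) (x, y) = {}"
      proof (rule ray_edges_empty[of "x - a K"])
        fix s assume "0 < s" "s < x - a K"
        then show "(x, y) + s *\<^sub>R (-1, 0) \<notin> (\<Union>K\<in>M. frontier K)"
          using cell_interior_not_grid[OF K(1), of "x - s" y] K by simp
      qed (use ab K in force)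
      show ?thesis
        by (rule T_vertexI(1)[OF int(1) _ none])
           (use vert[OF K(1)] K ray_edges_right[OF v left_end_right_covered[OF l]] in \<open>auto simp: axis_dirs_def\<close>)
    next
      assume r: "right_end x y"
      then obtain K where K: "K \<in> M" "a K = x" "c K < y" "y < d K" using right_end_cases int by force
      have none: "ray_edges M (1, 0) (x, y) = {}"
      proof (rule ray_edges_empty[of "b K - x"])
        fix s assume "0 < s" "s < b K - x"
        then show "(x, y) + s *\<^sub>R (1, 0) \<notin> (\<Union>K\<in>M. frontier K)"
          using cell_interior_not_grid[OF K(1), of "x + s" y] K by simp
      qed (use ab K in force)
      show ?thesis
        by (rule T_vertexI(1)[OF int(1) _ none])
           (use vert[OF K(1)] K ray_edges_left[OF v right_end_left_covered[OF r]] in \<open>auto simp: axis_dirs_def\<close>)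
    qed
  qed
  then show ?thesis using boundary_or_interior_vertex[OF v] by blast
qed

lemma vertical_end_vertex:
  assumes "T.left_end y x \<or> T.right_end y x"
  shows "(x, y) \<in> boundary_vertices M \<union> vertical_T_vertices M"
proof -
  have v: "vtx x y" using assms by (auto simp: T.left_end_def T.right_end_def transpose_vtx)
  have "(x, y) \<in> vertical_T_vertices M"
    if int: "(x, y) \<in> interior_vertices M" "A < x" "x < B" "C < y" "y < D"
  proof -
    have hor: "ray_edges M (1, 0) (x, y) \<noteq> {}" "ray_edges M (-1, 0) (x, y) \<noteq> {}"
      if "K \<in> M" "y = c K \<or> y = d K" "a K < x" "x < b K" for K
      using ray_edges_right[OF v] ray_edges_left[OF v] that
      by (force simp: right_covered_def left_covered_def)+
    show ?thesis using assms
    proof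
      assume l: "T.left_end y x"
      then obtain K where K: "K \<in> M" "d K = y" "a K < x" "x < b K" using T.left_end_cases int by force
      have none: "ray_edges M (0, -1) (x, y) = {}"
      proof (rule ray_edges_empty[of "y - c K"])
        fix s assume "0 < s" "s < y - c K"
        then show "(x, y) + s *\<^sub>R (0, -1) \<notin> (\<Union>K\<in>M. frontier K)"
          using cell_interior_not_grid[OF K(1), of x "y - s"] K by simp
      qed (use cd K in force)
      show ?thesis
        by (rule T_vertexI(2)[OF int(1) _ none])
           (use hor[OF K(1)] K ray_edges_up[OF v T.left_end_right_covered[OF l]] in \<open>auto simp: axis_dirs_def\<close>)
    next
      assume r: "T.right_end y x"
      then obtain K where K: "K \<in> M" "c K = y" "a K < x" "x < b K" using T.right_end_cases int by force
      have none: "ray_edges M (0, 1) (x, y) = {}"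
      proof (rule ray_edges_empty[of "d K - y"])
        fix s assume "0 < s" "s < d K - y"
        then show "(x, y) + s *\<^sub>R (0, 1) \<notin> (\<Union>K\<in>M. frontier K)"
          using cell_interior_not_grid[OF K(1), of x "y + s"] K by simp
      qed (use cd K in force)
      show ?thesis
        by (rule T_vertexI(2)[OF int(1) _ none])
           (use hor[OF K(1)] K ray_edges_down[OF v T.right_end_left_covered[OF r]] in \<open>auto simp: axis_dirs_def\<close>)
    qed
  qed
  then show ?thesis using boundary_or_interior_vertex[OF v] by blast
qed

text \<open>The ends of the maximal segments are boundary or T-vertices, so they are not among the crossing vertices.\<close>
lemma crossing_vertices_le:
  "int (card (crossing_vertices M)) \<le>
   int (card (vertices M)) - 2 * int (card left_ends) - 2 * int (card T.left_ends) + 4"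
proof -
  let ?E = "left_ends \<union> right_ends \<union> prod.swap ` (T.left_ends \<union> T.right_ends)"
  have E: "?E \<subseteq> vertices M"
    unfolding vertices_eq using transpose_vtx
    by (auto simp: left_ends_def right_ends_def T.left_ends_def T.right_ends_def
        left_end_def right_end_def T.left_end_def T.right_end_def)
  have "?E \<subseteq> boundary_vertices M \<union> T_vertices M"
  proof
    fix v assume "v \<in> ?E"
    then have "left_end (fst v) (snd v) \<or> right_end (fst v) (snd v) \<or> T.left_end (snd v) (fst v) \<or> T.right_end (snd v) (fst v)"
      by (auto simp: left_ends_def right_ends_def T.left_ends_def T.right_ends_def)
    then show "v \<in> boundary_vertices M \<union> T_vertices M"
      using horizontal_end_vertex[of "fst v" "snd v"] vertical_end_vertex[of "snd v" "fst v"]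
      by (auto simp: horizontal_T_vertices_def vertical_T_vertices_def)
  qed
  then have "?E \<inter> crossing_vertices M = {}"
    by (auto simp: crossing_vertices_def T_vertices_def interior_vertices_def boundary_vertices_def)
  moreover have sub: "crossing_vertices M \<subseteq> vertices M"
    by (auto simp: crossing_vertices_def interior_vertices_def)
  ultimately have "card ?E + card (crossing_vertices M) = card (?E \<union> crossing_vertices M)"
    using E finite_vertices by (intro card_Un_disjoint[symmetric]) (auto intro: finite_subset)
  also have "\<dots> \<le> card (vertices M)"
    using E sub finite_vertices by (intro card_mono) auto
  finally have "card ?E + card (crossing_vertices M) \<le> card (vertices M)" .
  then show ?thesis using two_card_ends_le by linarith
qed

lemma finite_interior_l_edges: "finite (interior_l_edges M)"
proof -
  have "interior_l_edges M \<subseteq> (\<lambda>(p, q). closed_segment p q) ` (vertices M \<times> vertices M)"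
    unfolding interior_l_edges_def horizontal_interior_l_edges_def vertical_interior_l_edges_def
      boundary_vertices_def horizontal_T_vertices_def vertical_T_vertices_def T_vertices_def
      interior_vertices_def by fast
  then show ?thesis using finite_vertices by (meson finite_SigmaI finite_imageI finite_subset)
qed

lemma horizontal_l_edge:
  assumes l: "left_end x y" and y: "C < y" "y < D"
  shows "\<exists>r. closed_segment (x, y) (r, y) \<in> horizontal_interior_l_edges M \<and> x < r"
proof -
  have v: "vtx x y" using l by (simp add: left_end_def)
  obtain r where r: "x \<le> r" "right_end r y" "\<forall>s\<in>{x..r}. hline s y" using ex_right_end[OF v] by blast
  have "x \<noteq> r" using l left_end_right_covered r(2) by (auto simp: right_end_def)
  then have xr: "x < r" using r(1) by simp
  have v': "vtx r y" using r(2) by (simp add: right_end_def)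
  have "\<exists>H. H \<subseteq> interior_edges M \<and> (\<forall>e\<in>H. \<exists>s t. s < t \<and> e = closed_segment ((x, y) + s *\<^sub>R (1, 0)) ((x, y) + t *\<^sub>R (1, 0))) \<and>
    closed_segment (x, y) ((x, y) + (r - x) *\<^sub>R (1, 0)) = \<Union>H"
  proof (rule segment_eq_Union_interior_edges[OF finite_vertices])
    show "closed_segment (x, y) ((x, y) + (r - x) *\<^sub>R (1, 0)) \<subseteq> (\<Union>K\<in>M. frontier K)"
      using horizontal_segment_grid[OF r(1,3)] by simp
    show "open_segment (x, y) ((x, y) + (r - x) *\<^sub>R (1, 0)) \<inter> frontier (region M) = {}"
      using open_segment_ray[of 0 "r - x" "(1, 0)" "(x, y)"] xr y vtx_bounds[OF v] vtx_bounds[OF v']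
      unfolding region_eq frontier_rectangle by (auto simp: zero_prod_def)
  qed (use xr v v' in \<open>auto simp: axis_dirs_def mem_vertices\<close>)
  then obtain H where H: "H \<subseteq> interior_edges M" "closed_segment (x, y) (r, y) = \<Union>H"
    "\<And>e. e \<in> H \<Longrightarrow> \<exists>s t. s < t \<and> e = closed_segment (x + s, y) (x + t, y)"
    by auto
  have "\<forall>e\<in>H. horizontal e" using H(3) by (force simp: horizontal_closed_segment)
  then have "closed_segment (x, y) (r, y) \<in> horizontal_interior_l_edges M"
    unfolding horizontal_interior_l_edges_def mem_Collect_eq
    using H(1,2) xr horizontal_end_vertex[of x y] horizontal_end_vertex[of r y] l r(2)
    by (intro exI[of _ "(x, y)"] exI[of _ "(r, y)"] conjI exI[of _ H]) auto
  then show ?thesis using xr by blast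
qed

lemma vertical_l_edge:
  assumes l: "T.left_end y x" and x: "A < x" "x < B"
  shows "\<exists>r. closed_segment (x, y) (x, r) \<in> vertical_interior_l_edges M \<and> y < r"
proof -
  have v: "T.vtx y x" using l by (simp add: T.left_end_def)
  obtain r where r: "y \<le> r" "T.right_end r x" "\<forall>s\<in>{y..r}. T.hline s x" using T.ex_right_end[OF v] by blast
  have "y \<noteq> r" using l T.left_end_right_covered r(2) by (auto simp: T.right_end_def)
  then have yr: "y < r" using r(1) by simp
  have v': "T.vtx r x" using r(2) by (simp add: T.right_end_def)
  have "\<exists>H. H \<subseteq> interior_edges M \<and> (\<forall>e\<in>H. \<exists>s t. s < t \<and> e = closed_segment ((x, y) + s *\<^sub>R (0, 1)) ((x, y) + t *\<^sub>R (0, 1))) \<and>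
    closed_segment (x, y) ((x, y) + (r - y) *\<^sub>R (0, 1)) = \<Union>H"
  proof (rule segment_eq_Union_interior_edges[OF finite_vertices])
    show "closed_segment (x, y) ((x, y) + (r - y) *\<^sub>R (0, 1)) \<subseteq> (\<Union>K\<in>M. frontier K)"
      using vertical_segment_grid[OF r(1,3)] by simp
    show "open_segment (x, y) ((x, y) + (r - y) *\<^sub>R (0, 1)) \<inter> frontier (region M) = {}"
      using open_segment_ray[of 0 "r - y" "(0, 1)" "(x, y)"] yr x T.vtx_bounds[OF v] T.vtx_bounds[OF v']
      unfolding region_eq frontier_rectangle by (auto simp: zero_prod_def)
  qed (use yr v v' in \<open>auto simp: axis_dirs_def mem_vertices transpose_vtx\<close>)
  then obtain H where H: "H \<subseteq> interior_edges M" "closed_segment (x, y) (x, r) = \<Union>H"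
    "\<And>e. e \<in> H \<Longrightarrow> \<exists>s t. s < t \<and> e = closed_segment (x, y + s) (x, y + t)"
    by auto
  have "\<forall>e\<in>H. vertical e" using H(3) by (force simp: vertical_closed_segment)
  then have "closed_segment (x, y) (x, r) \<in> vertical_interior_l_edges M"
    unfolding vertical_interior_l_edges_def mem_Collect_eq
    using H(1,2) yr vertical_end_vertex[of y x] vertical_end_vertex[of r x] l r(2)
    by (intro exI[of _ "(x, y)"] exI[of _ "(x, r)"] conjI exI[of _ H]) auto
  then show ?thesis using yr by blast
qed

text \<open>All horizontal segments are interior l-edges except the lower and the upper side of the region, with
left ends \<open>(A, C)\<close> and \<open>(A, D)\<close>.\<close>
lemma card_left_ends_le_l_edges: "card left_ends \<le> card (horizontal_interior_l_edges M) + 2"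
proof -
  let ?L = "left_ends - {(A, C), (A, D)}"
  have "\<exists>r. closed_segment p (r, snd p) \<in> horizontal_interior_l_edges M \<and> fst p < r" if "p \<in> ?L" for p
  proof -
    obtain x y where p: "p = (x, y)" "left_end x y" using \<open>p \<in> ?L\<close> by (auto simp: left_ends_def)
    then have "C \<le> y" "y \<le> D" using vtx_bounds by (auto simp: left_end_def)
    moreover have "y \<noteq> C" "y \<noteq> D" using left_end_boundary p \<open>p \<in> ?L\<close> by auto
    ultimately show ?thesis using horizontal_l_edge[OF p(2)] p(1) by auto
  qed
  then obtain r where r: "\<And>p. p \<in> ?L \<Longrightarrow> closed_segment p (r p, snd p) \<in> horizontal_interior_l_edges M \<and> fst p < r p"
    by metis
  have fin: "finite (horizontal_interior_l_edges M)"
    using finite_interior_l_edges by (rule finite_subset[rotated]) (simp add: interior_l_edges_def)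
  have "card ?L \<le> card (horizontal_interior_l_edges M)"
  proof (rule card_inj_on_le[of "\<lambda>p. closed_segment p (r p, snd p)"])
    show "inj_on (\<lambda>p. closed_segment p (r p, snd p)) ?L"
    proof (rule inj_onI)
      fix p q assume pq: "p \<in> ?L" "q \<in> ?L" "closed_segment p (r p, snd p) = closed_segment q (r q, snd q)"
      have "p = q \<or> p = (r q, snd q) \<and> (r p, snd p) = q"
        using pq(3) by (auto simp: doubleton_eq_iff)
      then show "p = q" using r[OF pq(1)] r[OF pq(2)] by (metis fst_conv order_less_asym)
    qed
  qed (use r fin in blast)+
  moreover have "card left_ends \<le> card ?L + 2"
    using diff_card_le_card_Diff[of "{(A, C), (A, D)}" left_ends] by (simp add: card_insert_if split: if_splits)
  ultimately show ?thesis by linarith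
qed

lemma card_bottom_ends_le_l_edges: "card T.left_ends \<le> card (vertical_interior_l_edges M) + 2"
proof -
  let ?L = "T.left_ends - {(C, A), (C, B)}"
  have "\<exists>r. closed_segment (prod.swap p) (snd p, r) \<in> vertical_interior_l_edges M \<and> fst p < r" if "p \<in> ?L" for p
  proof -
    obtain x y where p: "p = (y, x)" "T.left_end y x" using \<open>p \<in> ?L\<close> by (auto simp: T.left_ends_def)
    then have "A \<le> x" "x \<le> B" using T.vtx_bounds by (auto simp: T.left_end_def)
    moreover have "x \<noteq> A" "x \<noteq> B" using T.left_end_boundary p \<open>p \<in> ?L\<close> by auto
    ultimately show ?thesis using vertical_l_edge[OF p(2)] p(1) by auto
  qed
  then obtain r where r: "\<And>p. p \<in> ?L \<Longrightarrow> closed_segment (prod.swap p) (snd p, r p) \<in> vertical_interior_l_edges M \<and> fst p < r p"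
    by metis
  have fin: "finite (vertical_interior_l_edges M)"
    using finite_interior_l_edges by (rule finite_subset[rotated]) (simp add: interior_l_edges_def)
  have "card ?L \<le> card (vertical_interior_l_edges M)"
  proof (rule card_inj_on_le[of "\<lambda>p. closed_segment (prod.swap p) (snd p, r p)"])
    show "inj_on (\<lambda>p. closed_segment (prod.swap p) (snd p, r p)) ?L"
    proof (rule inj_onI)
      fix p q assume pq: "p \<in> ?L" "q \<in> ?L" "closed_segment (prod.swap p) (snd p, r p) = closed_segment (prod.swap q) (snd q, r q)"
      have "prod.swap p = prod.swap q \<or> prod.swap p = (snd q, r q) \<and> (snd p, r p) = prod.swap q"
        using pq(3) unfolding closed_segment_eq doubleton_eq_iff by blast
      then show "p = q" using r[OF pq(1)] r[OF pq(2)] by (auto simp: prod_eq_iff)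
    qed
  qed (use r fin in blast)+
  moreover have "card T.left_ends \<le> card ?L + 2"
    using diff_card_le_card_Diff[of "{(C, A), (C, B)}" T.left_ends] by (simp add: card_insert_if split: if_splits)
  ultimately show ?thesis by linarith
qed

lemma card_ends_le_l_edges: "card left_ends + card T.left_ends \<le> card (interior_l_edges M) + 4"
proof -
  have "horizontal_interior_l_edges M \<inter> vertical_interior_l_edges M = {}"
  proof -
    have "horizontal e \<and> \<not> vertical e" if "e \<in> horizontal_interior_l_edges M" for e
      using that unfolding horizontal_interior_l_edges_def
      by (auto simp: horizontal_closed_segment vertical_closed_segment prod_eq_iff)
    moreover have "vertical e" if "e \<in> vertical_interior_l_edges M" for e
      using that unfolding vertical_interior_l_edges_def by (auto simp: vertical_closed_segment)
    ultimately show ?thesis by blast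
  qed
  then have "card (interior_l_edges M) = card (horizontal_interior_l_edges M) + card (vertical_interior_l_edges M)"
    unfolding interior_l_edges_def
    using finite_interior_l_edges[unfolded interior_l_edges_def] by (intro card_Un_disjoint) auto
  then show ?thesis using card_left_ends_le_l_edges card_bottom_ends_le_l_edges by linarith
qed

end

section \<open>The coefficient equations of the spline space\<close>

lemma sum_fun_apply: "sum f S z = (\<Sum>s\<in>S. f s z)"
  by (induction S rule: infinite_finite_induct) auto

text \<open>Each point of the region is assigned to one of the cells that contain it. The monomials, cut off to the sets of
points assigned to a cell, span all piecewise polynomials; a fixed assignment avoids any
compatibility question on common sides.\<close>
lemma spline_space_bar_finite_dimensional:
  assumes "finite M"
  shows "\<exists>F. finite F \<and> spline_space_bar m n \<alpha> \<beta> M \<subseteq> fun_space.span F"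
proof -
  define \<kappa> where "\<kappa> z = (SOME K. K \<in> M \<and> z \<in> K)" for z
  have \<kappa>: "\<kappa> z \<in> M \<and> z \<in> \<kappa> z" if "z \<in> region M" for z
  proof -
    have "\<exists>K. K \<in> M \<and> z \<in> K" using that by (auto simp: region_def)
    then show ?thesis unfolding \<kappa>_def by (rule someI_ex)
  qed
  define g where "g K i j z = (if z \<in> region M \<and> \<kappa> z = K then fst z ^ i * snd z ^ j else 0 :: real)" for K i j z
  define F where "F = (\<Union>K\<in>M. \<Union>i\<le>m. \<Union>j\<le>n. {g K i j})"
  have "f \<in> fun_space.span F" if f: "f \<in> spline_space_bar m n \<alpha> \<beta> M" for f
  proof -
    have "\<forall>K\<in>M. \<exists>c. \<forall>x y. (x, y) \<in> K \<longrightarrow> f (x, y) = (\<Sum>i\<le>m. \<Sum>j\<le>n. c i j * x ^ i * y ^ j)"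
      using f unfolding spline_space_bar_def bipoly_on_def by blast
    from bchoice[OF this] obtain c where
      c: "\<forall>K\<in>M. \<forall>x y. (x, y) \<in> K \<longrightarrow> f (x, y) = (\<Sum>i\<le>m. \<Sum>j\<le>n. c K i j * x ^ i * y ^ j)" ..
    define h where "h = (\<Sum>K\<in>M. \<Sum>i\<le>m. \<Sum>j\<le>n. fun_scale (c K i j) (g K i j))"
    have h: "h z = (\<Sum>K\<in>M. \<Sum>i\<le>m. \<Sum>j\<le>n. c K i j * g K i j z)" for z
      unfolding h_def sum_fun_apply fun_scale_def ..
    have "f z = h z" for z
    proof (cases "z \<in> region M")
      case True
      have "h z = (\<Sum>K\<in>M. if \<kappa> z = K then \<Sum>i\<le>m. \<Sum>j\<le>n. c K i j * fst z ^ i * snd z ^ j else 0)"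
        unfolding h using True by (intro sum.cong refl) (simp add: g_def mult.assoc)
      also have "\<dots> = (\<Sum>i\<le>m. \<Sum>j\<le>n. c (\<kappa> z) i j * fst z ^ i * snd z ^ j)"
        using assms \<kappa>[OF True] by simp
      also have "\<dots> = f z"
        using c[rule_format, of "\<kappa> z" "fst z" "snd z"] \<kappa>[OF True] by simp
      finally show ?thesis ..
    next
      case False
      then have "f z = 0" using f unfolding spline_space_bar_def by blast
      moreover have "h z = 0" unfolding h using False by (simp add: g_def)
      ultimately show ?thesis by simp
    qed
    then have "f = h" by blast
    also have "h \<in> fun_space.span F"
      unfolding h_def
      by (intro fun_space.span_sum fun_space.span_scale fun_space.span_base) (auto simp: F_def)
    finally show ?thesis .
  qed
  moreover have "finite F" using assms by (simp add: F_def)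
  ultimately show ?thesis by blast
qed

context mesh_coords
begin

interpretation T: rect_partition M c d a b C D A B
  by (rule transpose)

text \<open>The maximal horizontal (vertical) grid segment through a vertex, represented by its left (lower) end. The lower end has
its ordinate first, as in the transposed partition.\<close>
definition hcomp :: "real \<times> real \<Rightarrow> real \<times> real" where
  "hcomp v = (leftmost (fst v) (snd v), snd v)"

definition vcomp :: "real \<times> real \<Rightarrow> real \<times> real" where
  "vcomp v = (T.leftmost (snd v) (fst v), fst v)"

lemma hcomp_left_ends: "v \<in> vertices M \<Longrightarrow> hcomp v \<in> left_ends"
  using leftmost_left_end by (auto simp: hcomp_def left_ends_def vertices_eq)

lemma vcomp_bottom_ends: "v \<in> vertices M \<Longrightarrow> vcomp v \<in> T.left_ends"
  using T.leftmost_left_end by (auto simp: vcomp_def T.left_ends_def vertices_eq transpose_vtx)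

text \<open>On a cell \<open>K\<close> the vertices to the lower left contribute biquadratic terms, and those beyond the upper or right
side contribute nothing. Each remaining vertex has one coordinate strictly between those of two opposite sides of \<open>K\<close>; these
vertices form whole segments, below or to the left of \<open>K\<close>, and cancel by the vanishing moments. To the right of the region and above it all segments cancel.\<close>
lemma spline_of_in_space:
  assumes h: "\<And>u k. u \<in> vertices M \<Longrightarrow> k \<le> 2 \<Longrightarrow> (\<Sum>v\<in>{v\<in>vertices M. hcomp v = hcomp u}. w v * fst v ^ k) = 0"
    and v: "\<And>u k. u \<in> vertices M \<Longrightarrow> k \<le> 2 \<Longrightarrow> (\<Sum>v\<in>{v\<in>vertices M. vcomp v = vcomp u}. w v * snd v ^ k) = 0"
  shows "spline_of (vertices M) w \<in> spline_space_bar 2 2 1 1 M"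
proof -
  let ?V = "vertices M" and ?f = "spline_of (vertices M) w"
  have bd: "A \<le> fst v" "fst v \<le> B" "C \<le> snd v" "snd v \<le> D" if "v \<in> ?V" for v
    using that vtx_bounds[of "fst v" "snd v"] by (auto simp: vertices_eq)
  have hsum: "(\<Sum>v\<in>U. w v * (x - fst v)^2 * trunc_sq (y - snd v)) = 0"
    if "U \<subseteq> ?V" "\<And>u v. u \<in> U \<Longrightarrow> v \<in> ?V \<Longrightarrow> hcomp u = hcomp v \<Longrightarrow> v \<in> U" for U x y
    by (rule saturated_sum_eq_0[where \<kappa> = hcomp, OF finite_vertices that _ h]) (auto simp: hcomp_def)
  have vsum: "(\<Sum>v\<in>U. w v * trunc_sq (x - fst v) * (y - snd v)^2) = 0"
    if "U \<subseteq> ?V" "\<And>u v. u \<in> U \<Longrightarrow> v \<in> ?V \<Longrightarrow> vcomp u = vcomp v \<Longrightarrow> v \<in> U" for U x y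
  proof -
    have "(\<Sum>v\<in>U. w v * (y - snd v)^2 * trunc_sq (x - fst v)) = 0"
      by (rule saturated_sum_eq_0[where \<kappa> = vcomp, OF finite_vertices that _ v]) (auto simp: vcomp_def)
    then show ?thesis by (simp add: mult.assoc mult.commute[of "trunc_sq _"])
  qed
  have out: "?f (x, y) = 0" if "(x, y) \<notin> region M" for x y
  proof -
    have "x < A \<or> y < C \<or> B < x \<or> D < y" using that by (auto simp: region_eq)
    then consider "x < A \<or> y < C" | "B < x" | "D < y" by blast
    then show ?thesis
    proof cases
      case 1
      then show ?thesis
        using bd by (fastforce simp: spline_of_def trunc_sq_nonpos intro!: sum.neutral)
    next
      case 2
      have "?f (x, y) = (\<Sum>v\<in>?V. w v * (x - fst v)^2 * trunc_sq (y - snd v))"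
        unfolding spline_of_def using 2 bd by (intro sum.cong) (fastforce simp: trunc_sq_nonneg)+
      then show ?thesis using hsum[of ?V] by simp
    next
      case 3
      have "?f (x, y) = (\<Sum>v\<in>?V. w v * trunc_sq (x - fst v) * (y - snd v)^2)"
        unfolding spline_of_def using 3 bd by (intro sum.cong) (fastforce simp: trunc_sq_nonneg)+
      then show ?thesis using vsum[of ?V] by simp
    qed
  qed
  have "bipoly_on 2 2 K ?f" if K: "K \<in> M" for K
  proof -
    \<comment> \<open>The vertices to the lower left of the cell, below it, and to the left of it.\<close>
    define P where "P v \<longleftrightarrow> fst v \<le> a K \<and> snd v \<le> c K" for v
    define Q where "Q v \<longleftrightarrow> a K < fst v \<and> fst v < b K \<and> snd v \<le> c K" for v
    define R where "R v \<longleftrightarrow> fst v \<le> a K \<and> c K < snd v \<and> snd v < d K" for v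
    have Q0: "(\<Sum>v\<in>{v\<in>?V. Q v}. w v * trunc_sq (x - fst v) * (y - snd v)^2) = 0" for x y
    proof (rule vsum)
      fix u v assume "u \<in> {v \<in> ?V. Q v}" "v \<in> ?V" "vcomp u = vcomp v"
      then show "v \<in> {v \<in> ?V. Q v}"
        using T.component_beside_cell[of "snd u" "fst u" "snd v" K] K
        by (auto simp: Q_def vcomp_def vertices_eq transpose_vtx)
    qed auto
    have R0: "(\<Sum>v\<in>{v\<in>?V. R v}. w v * (x - fst v)^2 * trunc_sq (y - snd v)) = 0" for x y
    proof (rule hsum)
      fix u v assume "u \<in> {v \<in> ?V. R v}" "v \<in> ?V" "hcomp u = hcomp v"
      then show "v \<in> {v \<in> ?V. R v}"
        using component_beside_cell[of "fst u" "snd u" "fst v" K] K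
        by (auto simp: R_def hcomp_def vertices_eq)
    qed auto
    obtain q where q: "\<And>x y. (\<Sum>v\<in>{v\<in>?V. P v}. w v * (x - fst v)^2 * (y - snd v)^2) = (\<Sum>i\<le>2. \<Sum>j\<le>2. q i j * x ^ i * y ^ (j::nat))"
      using biquadratic_sum[of w "{v\<in>?V. P v}"] by blast
    have "?f (x, y) = (\<Sum>i\<le>2. \<Sum>j\<le>2. q i j * x ^ i * y ^ j)" if "(x, y) \<in> K" for x y
    proof -
      have xy: "a K \<le> x" "x \<le> b K" "c K \<le> y" "y \<le> d K" using that mem_cell[OF K] by auto
      have split: "w v * trunc_sq (x - fst v) * trunc_sq (y - snd v) =
          (if P v then w v * (x - fst v)^2 * (y - snd v)^2 else 0)
        + (if Q v then w v * trunc_sq (x - fst v) * (y - snd v)^2 else 0)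
        + (if R v then w v * (x - fst v)^2 * trunc_sq (y - snd v) else 0)" if "v \<in> ?V" for v
      proof (cases "b K \<le> fst v \<or> d K \<le> snd v")
        case True
        then have "trunc_sq (x - fst v) = 0 \<or> trunc_sq (y - snd v) = 0"
          using xy by (auto simp: trunc_sq_nonpos)
        moreover have "\<not> P v" using True ab[OF K] cd[OF K] by (auto simp: P_def)
        moreover have "Q v \<Longrightarrow> False" using True cd[OF K] by (auto simp: Q_def)
        moreover have "R v \<Longrightarrow> False" using True ab[OF K] by (auto simp: R_def)
        ultimately show ?thesis by auto
      next
        case False
        have "\<not> (a K < fst v \<and> c K < snd v)"
          using hline_open_box[OF K, of "fst v" "snd v"] vtx_hline[of "fst v" "snd v"] \<open>v \<in> ?V\<close> False
          by (auto simp: vertices_eq)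
        then consider "P v" "\<not> Q v" "\<not> R v" | "Q v" "\<not> P v" "\<not> R v" | "R v" "\<not> P v" "\<not> Q v"
          using False unfolding P_def Q_def R_def by linarith
        then show ?thesis
        proof cases
          case 1
          then have "0 \<le> x - fst v" "0 \<le> y - snd v" using xy by (auto simp: P_def)
          then show ?thesis using 1 by (simp add: trunc_sq_nonneg)
        next
          case 2
          then have "0 \<le> y - snd v" using xy by (auto simp: Q_def)
          then show ?thesis using 2 by (simp add: trunc_sq_nonneg)
        next
          case 3
          then have "0 \<le> x - fst v" using xy by (auto simp: R_def)
          then show ?thesis using 3 by (simp add: trunc_sq_nonneg)
        qed
      qed
      have "?f (x, y) = (\<Sum>v\<in>{v\<in>?V. P v}. w v * (x - fst v)^2 * (y - snd v)^2)
          + (\<Sum>v\<in>{v\<in>?V. Q v}. w v * trunc_sq (x - fst v) * (y - snd v)^2)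
          + (\<Sum>v\<in>{v\<in>?V. R v}. w v * (x - fst v)^2 * trunc_sq (y - snd v))"
        unfolding sum.inter_filter[OF finite_vertices] sum.distrib[symmetric] spline_of_def fst_conv snd_conv
        by (rule sum.cong[OF refl split])
      then show ?thesis using Q0 R0 q by simp
    qed
    then show ?thesis unfolding bipoly_on_def by blast
  qed
  then show ?thesis using out C_class_spline_of by (auto simp: spline_space_bar_def)
qed

text \<open>Both groupings of \<open>\<Sum>v. w v * x\<^sub>v ^ i * y\<^sub>v ^ j\<close> are moment sums: by vertical segments it vanishes, by
horizontal ones it reduces to the segments of \<open>p1\<close>, \<open>p2\<close>, \<open>p3\<close> weighted with \<open>j\<close>-th powers of their levels.
The Vandermonde system for \<open>j \<le> 2\<close> makes these three moments vanish as well.\<close>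
lemma redundant_moments:
  assumes p: "p1 \<in> left_ends" "p2 \<in> left_ends" "p3 \<in> left_ends"
    and ne: "snd p1 \<noteq> snd p2" "snd p1 \<noteq> snd p3" "snd p2 \<noteq> snd p3"
    and h: "\<And>p k. p \<in> left_ends - {p1, p2, p3} \<Longrightarrow> k \<le> (2::nat) \<Longrightarrow> (\<Sum>v\<in>{v\<in>vertices M. hcomp v = p}. w v * fst v ^ k) = 0"
    and v: "\<And>p k. p \<in> T.left_ends \<Longrightarrow> k \<le> (2::nat) \<Longrightarrow> (\<Sum>v\<in>{v\<in>vertices M. vcomp v = p}. w v * snd v ^ k) = 0"
    and "p \<in> left_ends" "i \<le> 2"
  shows "(\<Sum>v\<in>{v\<in>vertices M. hcomp v = p}. w v * fst v ^ i) = 0"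
proof -
  let ?V = "vertices M"
  define m where "m q = (\<Sum>v\<in>{v\<in>?V. hcomp v = q}. w v * fst v ^ i)" for q
  have "snd p1 ^ j * m p1 + snd p2 ^ j * m p2 + snd p3 ^ j * m p3 = 0" if "j \<le> 2" for j
  proof -
    have "(\<Sum>v\<in>?V. w v * fst v ^ i * snd v ^ j) =
        (\<Sum>q\<in>T.left_ends. \<Sum>v\<in>{v\<in>?V. vcomp v = q}. w v * fst v ^ i * snd v ^ j)"
      using finite_vertices T.finite_left_ends vcomp_bottom_ends by (intro sum.group[symmetric]) auto
    also have "\<dots> = (\<Sum>q\<in>T.left_ends. snd q ^ i * (\<Sum>v\<in>{v\<in>?V. vcomp v = q}. w v * snd v ^ j))"
      unfolding sum_distrib_left by (intro sum.cong refl) (auto simp: vcomp_def)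
    also have "\<dots> = 0" using v[OF _ \<open>j \<le> 2\<close>] by simp
    finally have "0 = (\<Sum>v\<in>?V. w v * fst v ^ i * snd v ^ j)" by simp
    also have "\<dots> = (\<Sum>q\<in>left_ends. \<Sum>v\<in>{v\<in>?V. hcomp v = q}. w v * fst v ^ i * snd v ^ j)"
      using finite_vertices finite_left_ends hcomp_left_ends by (intro sum.group[symmetric]) auto
    also have "\<dots> = (\<Sum>q\<in>left_ends. snd q ^ j * m q)"
      unfolding sum_distrib_left m_def by (intro sum.cong refl) (auto simp: hcomp_def)
    also have "\<dots> = (\<Sum>q\<in>{p1, p2, p3}. snd q ^ j * m q)"
      using finite_left_ends p h[OF _ \<open>i \<le> 2\<close>] by (intro sum.mono_neutral_right) (auto simp: m_def)
    also have "\<dots> = snd p1 ^ j * m p1 + snd p2 ^ j * m p2 + snd p3 ^ j * m p3"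
    proof -
      have "p1 \<noteq> p2" "p1 \<noteq> p3" "p2 \<noteq> p3" using ne by auto
      then show ?thesis by simp
    qed
    finally show ?thesis ..
  qed
  from vandermonde3[OF ne this] have "m p1 = 0" "m p2 = 0" "m p3 = 0" by auto
  then show ?thesis using h[of p i] assms(9,10) by (cases "p \<in> {p1, p2, p3}") (auto simp: m_def)
qed

text \<open>The three levels are the lower side, the upper side and the level of an interior vertex.\<close>
lemma ex_left_ends_three_levels:
  assumes "interior_vertices M \<noteq> {}"
  obtains p1 p2 p3 where "p1 \<in> left_ends" "p2 \<in> left_ends" "p3 \<in> left_ends"
    "snd p1 \<noteq> snd p2" "snd p1 \<noteq> snd p3" "snd p2 \<noteq> snd p3"
proof -
  have level: "\<exists>p\<in>left_ends. snd p = y" if "vtx x y" for x y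
    using hcomp_left_ends[of "(x, y)"] that
    by (intro bexI[of _ "hcomp (x, y)"]) (simp_all add: mem_vertices hcomp_def)
  obtain x y where v: "(x, y) \<in> interior_vertices M" using assms by auto
  then have "vtx x y" by (simp add: interior_vertices_def mem_vertices)
  moreover have "C < y" "y < D"
    using boundary_or_interior_vertex[OF \<open>vtx x y\<close>] v
    by (auto simp: interior_vertices_def boundary_vertices_def)
  moreover obtain K where "K \<in> M" "c K \<le> C" using cover[of A C] AB CD by auto
  then have "vtx (a K) C" using bounds(3)[of K] by (auto simp: vtx_def)
  moreover obtain L where "L \<in> M" "D \<le> d L" using cover[of A D] AB CD by auto
  then have "vtx (a L) D" using bounds(4)[of L] by (force simp: vtx_def)
  ultimately show thesis using level that CD by (metis less_irrefl)
qed

text \<open>Omitting the equations of three segments on different levels leaves \<open>3 N - 9\<close> equations, and their solutions embed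
into the spline space.\<close>
lemma vertices_le_dim_spline_space:
  assumes "interior_vertices M \<noteq> {}"
  shows "int (card (vertices M)) - 3 * int (card left_ends) - 3 * int (card T.left_ends) + 9
    \<le> int (fun_space.dim (spline_space_bar 2 2 1 1 M))"
proof -
  let ?V = "vertices M"
  obtain p1 p2 p3 where p: "p1 \<in> left_ends" "p2 \<in> left_ends" "p3 \<in> left_ends"
    and ne: "snd p1 \<noteq> snd p2" "snd p1 \<noteq> snd p3" "snd p2 \<noteq> snd p3"
    by (rule ex_left_ends_three_levels[OF assms])
  define gh where "gh = (\<lambda>(p, k::nat) v. if hcomp v = p then fst v ^ k else 0)"
  define gv where "gv = (\<lambda>(p, k::nat) v. if vcomp v = p then snd v ^ k else 0)"
  define G where "G = gh ` ((left_ends - {p1, p2, p3}) \<times> {..2}) \<union> gv ` (T.left_ends \<times> {..2})"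
  have finG: "finite G" using finite_left_ends T.finite_left_ends by (simp add: G_def)
  have "card G \<le> card (gh ` ((left_ends - {p1, p2, p3}) \<times> {..2})) + card (gv ` (T.left_ends \<times> {..2}))"
    unfolding G_def by (rule card_Un_le)
  also have "\<dots> \<le> card ((left_ends - {p1, p2, p3}) \<times> {..2::nat}) + card (T.left_ends \<times> {..2::nat})"
    using finite_left_ends T.finite_left_ends by (intro add_mono card_image_le) auto
  also have "\<dots> = 3 * card (left_ends - {p1, p2, p3}) + 3 * card T.left_ends"
    by (simp add: card_cartesian_product)
  finally have cardG: "card G \<le> 3 * card (left_ends - {p1, p2, p3}) + 3 * card T.left_ends" .
  have "card {p1, p2, p3} = 3" using ne by (auto simp: card_insert_if)
  then have card3: "card left_ends = card (left_ends - {p1, p2, p3}) + 3"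
    using p card_Diff_subset[of "{p1, p2, p3}" left_ends] card_mono[OF finite_left_ends, of "{p1, p2, p3}"] by simp
  have sub: "spline_of ?V ` solutions ?V G \<subseteq> spline_space_bar 2 2 1 1 M"
  proof
    fix f assume "f \<in> spline_of ?V ` solutions ?V G"
    then obtain w where w: "f = spline_of ?V w" "\<And>g. g \<in> G \<Longrightarrow> (\<Sum>v\<in>?V. g v * w v) = 0"
      by (auto simp: solutions_def)
    have h: "(\<Sum>v\<in>{v\<in>?V. hcomp v = p}. w v * fst v ^ k) = 0"
      if "p \<in> left_ends - {p1, p2, p3}" "k \<le> 2" for p k
    proof -
      have "(\<Sum>v\<in>?V. gh (p, k) v * w v) = 0" using that by (intro w(2)) (auto simp: G_def)
      also have "(\<Sum>v\<in>?V. gh (p, k) v * w v) = (\<Sum>v\<in>{v\<in>?V. hcomp v = p}. w v * fst v ^ k)"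
        unfolding sum.inter_filter[OF finite_vertices] by (intro sum.cong) (auto simp: gh_def)
      finally show ?thesis .
    qed
    have v: "(\<Sum>v\<in>{v\<in>?V. vcomp v = p}. w v * snd v ^ k) = 0" if "p \<in> T.left_ends" "k \<le> 2" for p k
    proof -
      have "(\<Sum>v\<in>?V. gv (p, k) v * w v) = 0" using that by (intro w(2)) (auto simp: G_def)
      also have "(\<Sum>v\<in>?V. gv (p, k) v * w v) = (\<Sum>v\<in>{v\<in>?V. vcomp v = p}. w v * snd v ^ k)"
        unfolding sum.inter_filter[OF finite_vertices] by (intro sum.cong) (auto simp: gv_def)
      finally show ?thesis .
    qed
    show "f \<in> spline_space_bar 2 2 1 1 M"
      unfolding w(1) using redundant_moments[OF p ne h v] v hcomp_left_ends vcomp_bottom_ends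
      by (intro spline_of_in_space) auto
  qed
  obtain B where B: "B \<subseteq> solutions ?V G" "fun_space.independent B" "solutions ?V G \<subseteq> fun_space.span B"
      "card B = fun_space.dim (solutions ?V G)"
    by (rule fun_space.basis_exists)
  have "fun_space.span B \<subseteq> solutions ?V G"
    using B(1) subspace_solutions by (rule fun_space.span_minimal)
  also have "\<dots> \<subseteq> supported_on ?V" by (auto simp: solutions_def)
  finally have inj: "inj_on (spline_of ?V) (fun_space.span B)"
    using inj_on_spline_of[OF finite_vertices] inj_on_subset by blast
  interpret vector_space_pair fun_scale fun_scale ..
  have ind: "fun_space.independent (spline_of ?V ` B)"
    using linear_spline_of B(2) inj by (rule linear_independent_injective_image)
  obtain F where F: "finite F" "spline_space_bar 2 2 1 1 M \<subseteq> fun_space.span F"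
    using spline_space_bar_finite_dimensional[OF finite_I] by blast
  have "card B = card (spline_of ?V ` B)"
    using inj fun_space.span_superset by (intro card_image[symmetric]) (rule inj_on_subset)
  also have "\<dots> \<le> fun_space.dim (spline_space_bar 2 2 1 1 M)"
    using F(2,1) _ ind by (rule fun_space.card_independent_le_dim) (use B(1) sub in blast)
  finally have "fun_space.dim (solutions ?V G) \<le> fun_space.dim (spline_space_bar 2 2 1 1 M)"
    using B(4) by simp
  then show ?thesis
    using card_le_dim_solutions[OF finite_vertices finG] cardG card3 by linarith
qed

lemma dim_spline_space_ge:
  assumes "interior_vertices M \<noteq> {}"
  shows "int (fun_space.dim (spline_space_bar 2 2 1 1 M))
           \<ge> int (card (crossing_vertices M)) - int (card (interior_l_edges M)) + 1"
  using vertices_le_dim_spline_space[OF assms] crossing_vertices_le card_ends_le_l_edges by linarith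

end

lemma regular_T_mesh_coords:
  assumes "regular_T_mesh M"
  obtains a b c d A B C D where "mesh_coords M a b c d A B C D"
proof -
  have M: "finite M" "\<And>K. K \<in> M \<Longrightarrow> is_rectangle K"
    "\<And>K L. K \<in> M \<Longrightarrow> L \<in> M \<Longrightarrow> K \<noteq> L \<Longrightarrow> interior K \<inter> interior L = {}"
    and reg: "is_rectangle (region M)"
    using assms by (auto simp: regular_T_mesh_def T_mesh_def)
  obtain a b c d where K: "\<And>K. K \<in> M \<Longrightarrow> a K < b K \<and> c K < d K \<and> K = {a K..b K} \<times> {c K..d K}"
    using M(2) unfolding is_rectangle_def by metis
  obtain A B C D where R: "A < B" "C < D" "region M = {A..B} \<times> {C..D}"
    using reg unfolding is_rectangle_def by metis
  have mem: "(x, y) \<in> K \<longleftrightarrow> a K \<le> x \<and> x \<le> b K \<and> c K \<le> y \<and> y \<le> d K" if "K \<in> M" for K x y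
    using K[OF that] by (metis atLeastAtMost_iff mem_Sigma_iff)
  have interior: "interior K = {a K<..<b K} \<times> {c K<..<d K}" if "K \<in> M" for K
    using K[OF that] by (metis interior_Times interior_atLeastAtMost_real)
  have "mesh_coords M a b c d A B C D"
  proof
    fix K L assume KL: "K \<in> M" "L \<in> M" "K \<noteq> L"
    show "b K \<le> a L \<or> b L \<le> a K \<or> d K \<le> c L \<or> d L \<le> c K"
    proof (rule ccontr)
      assume "\<not> ?thesis"
      then have "max (a K) (a L) < min (b K) (b L)" "max (c K) (c L) < min (d K) (d L)"
        using K[OF KL(1)] K[OF KL(2)] by auto
      then obtain x y where "max (a K) (a L) < x" "x < min (b K) (b L)" "max (c K) (c L) < y" "y < min (d K) (d L)"
        using dense by metis
      then have "(x, y) \<in> interior K \<inter> interior L" using interior KL by simp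
      then show False using M(3) KL by blast
    qed
  next
    fix x y
    show "(\<exists>K\<in>M. a K \<le> x \<and> x \<le> b K \<and> c K \<le> y \<and> y \<le> d K) \<longleftrightarrow> A \<le> x \<and> x \<le> B \<and> C \<le> y \<and> y \<le> D"
    proof -
      have "(\<exists>K\<in>M. a K \<le> x \<and> x \<le> b K \<and> c K \<le> y \<and> y \<le> d K) \<longleftrightarrow> (x, y) \<in> region M"
        using mem by (auto simp: region_def)
      then show ?thesis using R by simp
    qed
  qed (use M K R in blast)+
  then show thesis by (rule that)
qed

theorem theorem4p4:
  fixes M :: "(real \<times> real) set set"
  assumes "regular_T_mesh M"
    and "card (crossing_vertices M) > 0"
  shows "int (fun_space.dim (spline_space_bar 2 2 1 1 M))
           \<ge> int (card (crossing_vertices M)) - int (card (interior_l_edges M)) + 1"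
proof -
  obtain a b c d A B C D where "mesh_coords M a b c d A B C D"
    using regular_T_mesh_coords[OF assms(1)] .
  then interpret mesh_coords M a b c d A B C D .
  have "crossing_vertices M \<noteq> {}" using assms(2) by auto
  then have "interior_vertices M \<noteq> {}" by (auto simp: crossing_vertices_def)
  then show ?thesis by (rule dim_spline_space_ge)
qed

end
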